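(* Let $q,p\in(0,2]$ and, for $\lambda>0$, $\Phi_\lambda(U,V)=F(UV^T)+\frac\lambda q\|U\|_{2,q}^q+\frac\lambda p\|V\|_{2,p}^p$ on $\mathbb{R}^{m\times d}\times\mathbb{R}^{n\times d}$. Let $\{(U^k,V^k)\}_{k\ge0}$ be an infinite sequence generated by the inexact proximal alternating linearized minimization method (described in the context), and write $W^k=(U^k;V^k)$. Assume: (A1) $F$ is continuously differentiable, proper and bounded below; (A2) $\Phi_{\lambda_0}$ has a critical point; (A3) $\nabla F^k$ and $\nabla\bar F^k$ are Lipschitz continuous with constants $L_1^k/2$ and $L_2^k/2$ respectively, and there are constants $0<l<L<+\infty$ with $l\le L_1^k,L_2^k\le L$ for all $k$; (C) the weights $\beta_k$ are such that $\Phi_\lambda^{k+1}(U^{k+1},V^{k+1})\le\Phi_\lambda^{k+1}(U^k,V^k)$, and there is $\delta_\beta<1$ such that $0\le\beta_k\le\frac16\delta_\beta\min\left\{\sqrt{L_1^{k-1}/L_1^k},\sqrt{L_2^{k-1}/L_2^k}\right\}$ uniformly over all $k$. Then $\{(U^k,V^k)\}$ is bounded and $$\sum_{k=0}^{+\infty}\|W^{k+1}-W^k\|_F^2<+\infty.$$ Any limit point $(\bar U,\bar V)$ of $\{(U^k,V^k)\}$ is a critical point of $\Phi_{\lambda_0}$. Furthermore, if a subsequence $\{(U^k,V^k)\}_{k\in\mathcal{K}}$ converges to $(\bar U,\bar V)$, then $$\lim_{k\to\infty,\,k\in\mathcal{K}}\Phi_{\lambda_0}(U^k,V^k)=\Phi_{\lambda_0}(\bar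 U,\bar V).$$
   Context: Notation: $A_t=A_{:,t}$ is the $t$-th column of $A$; $\|A\|_{2,q}^q=\sum_t\|A_t\|_2^q$; $F(U,V):=F(UV^T)$; $F^k(U)=F(U,V^k)$, $\bar F^k(V)=F(U^{k+1},V)$; $\operatorname{prox}_h(x)=\arg\min_y\frac12\|y-x\|^2+h(y)$. A critical point of $\Phi$ is a point where $0$ lies in the limiting Fréchet subdifferential. Algorithm (inexact proximal alternating linearized minimization). Choose $\lambda^0>\lambda_0>0$, $\varrho\in(0,1)$, a bound $\beta^*\geq 0$, step parameters $L_1^k,L_2^k>0$, tolerances $\delta_k\in[0,\frac14]$ with $\delta_k\to0$ and $\sum_k\delta_k<\infty$, and $(U^{-1},V^{-1})=(U^0,V^0)$. At iteration $k\geq 0$, with extrapolation weight $\beta_k\in[0,\beta^*]$, put $\widetilde U^k=U^k+\beta_k(U^k-U^{k-1})$, $\widetilde V^k=V^k+\beta_k(V^k-V^{k-1})$. First $U^{k+1}$ is a (possibly inexact) minimizer over $U$ of $\langle\nabla F^k(\widetilde U^k),U-\widetilde U^k\rangle+\frac{L_1^k}2\|U-\widetilde U^k\|_F^2+\frac{\lambda^k}q\|U\|_{2,q}^q$, then $V^{k+1}$ is a (possibly inexact) minimizer over $V$ of $\langle\nabla\bar F^k(\widetilde V^k),V-\widetilde V^k\rangle+\frac{L_2^k}2\|V-\widetilde V^k\|_F^2+\frac{\lambda^k}p\|V\|_{2,p}^p$. Inexactness with tolerance $\delta_k$ means that there are $\lambda_{1,t}^k,\lambda_{2,t}^k>0$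 ($t=1,\dots,d$) with $$U_t^{k+1}\in\operatorname{prox}_{\frac{\lambda_{1,t}^k}{qL_1^k}\|\cdot\|_2^q}\left(\left(\widetilde U^k-\tfrac1{L_1^k}\nabla F^k(\widetilde U^k)\right)_t\right),\qquad V_t^{k+1}\in\operatorname{prox}_{\frac{\lambda_{2,t}^k}{pL_2^k}\|\cdot\|_2^p}\left(\left(\widetilde V^k-\tfrac1{L_2^k}\nabla\bar F^k(\widetilde V^k)\right)_t\right),$$ $$\left|\left(\lambda^k/\lambda_{1,t}^k\right)^{\frac1{q+1}}-1\right|\le\delta_k,\qquad\left|\left(\lambda^k/\lambda_{2,t}^k\right)^{\frac1{p+1}}-1\right|\le\delta_k$$ (exact solution: $\lambda_{i,t}^k=\lambda^k$). Then $\lambda^{k+1}=\max\{\varrho\lambda^k,\lambda_0\}$. Rank adjustment: zero columns of $U^{k+1}$ or $V^{k+1}$ are removed (same column indices in all iterates in use) and $d$ is decreased; this happens only finitely often, and statements about the sequence refer to iterates after $d$ has become constant. The stopping test is disregarded. Perturbed objective: $\Phi_\lambda^{k+1}(U,V)=F(UV^T)+\sum_{t=1}^d\frac{\lambda_{1,t}^k}q\|U_t\|_2^q+\sum_{t=1}^d\frac{\lambda_{2,t}^k}p\|V_t\|_2^p$. *)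

theory Defs
  imports "HOL-Analysis.Analysis"
begin

section \<open>Gradients, proximal mappings and limiting subdifferentials\<close>

text \<open>On matrices \<open>real ^ 'd ^ 'm\<close> the library inner product and norm are the Frobenius ones, and on
  pairs \<open>(U, V)\<close> the norm is the Frobenius norm of the stacked matrix \<open>(U; V)\<close>.\<close>

definition grad :: "('a::real_inner \<Rightarrow> real) \<Rightarrow> 'a \<Rightarrow> 'a" where
  "grad f x = (THE g. GDERIV f x :> g)"

definition prox :: "('a::real_inner \<Rightarrow> real) \<Rightarrow> 'a \<Rightarrow> 'a set" where
  "prox h x = {y. is_arg_min (\<lambda>y. 1/2 * (norm (y - x))\<^sup>2 + h y) (\<lambda>_. True) y}"

text \<open>Subdifferentials of a function on the Euclidean space \<open>S\<close>, given as a linear subspace of the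
  ambient type; \<open>S = UNIV\<close> gives the usual notions.\<close>

definition frechet_subdifferential ::
    "'a::real_inner set \<Rightarrow> ('a \<Rightarrow> real) \<Rightarrow> 'a \<Rightarrow> 'a set" where
  "frechet_subdifferential S f x =
     {v \<in> S. 0 \<le> Liminf (at x within S)
        (\<lambda>y. ereal ((f y - f x - inner v (y - x)) / norm (y - x)))}"

definition limiting_subdifferential ::
    "'a::real_inner set \<Rightarrow> ('a \<Rightarrow> real) \<Rightarrow> 'a \<Rightarrow> 'a set" where
  "limiting_subdifferential S f x =
     {v. \<exists>y w. (\<forall>j::nat. y j \<in> S \<and> w j \<in> frechet_subdifferential S f (y j)) \<and>
            y \<longlonglongrightarrow> x \<and> (\<lambda>j. f (y j)) \<longlonglongrightarrow> f x \<and> w \<longlonglongrightarrow> v}"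

definition critical_point :: "'a::real_inner set \<Rightarrow> ('a \<Rightarrow> real) \<Rightarrow> 'a \<Rightarrow> bool" where
  "critical_point S f x \<longleftrightarrow> x \<in> S \<and> 0 \<in> limiting_subdifferential S f x"


section \<open>Matrices with a set of active columns\<close>

text \<open>The rank adjustment deletes columns, so the number of columns is not fixed along the
  algorithm. A matrix with columns indexed by \<open>J\<close> is represented as a matrix over the initial column
  index type whose columns outside \<open>J\<close> vanish; \<open>J\<close> consists of the columns not yet deleted, and
  \<open>card J\<close> is the current value of \<open>d\<close> (possibly \<open>0\<close>).\<close>

definition col_space :: "'d set \<Rightarrow> (real ^ 'd ^ 'm) set" where
  "col_space J = {A. \<forall>t. t \<notin> J \<longrightarrow> column t A = 0}"

definition keep_columns :: "'d set \<Rightarrow> real ^ 'd ^ 'm \<Rightarrow> real ^ 'd ^ 'm" where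
  "keep_columns J A = (\<chi> i t. if t \<in> J then A $ i $ t else 0)"

definition objective ::
    "(real ^ 'n ^ 'm \<Rightarrow> real) \<Rightarrow> real \<Rightarrow> real \<Rightarrow> 'd::finite set \<Rightarrow> real \<Rightarrow>
     (real ^ 'd ^ 'm) \<times> (real ^ 'd ^ 'n) \<Rightarrow> real" where
  "objective F q p J lambda = (\<lambda>(U, V). F (U ** transpose V)
     + lambda / q * (\<Sum>t\<in>J. norm (column t U) powr q)
     + lambda / p * (\<Sum>t\<in>J. norm (column t V) powr p))"

definition perturbed_objective ::
    "(real ^ 'n ^ 'm \<Rightarrow> real) \<Rightarrow> real \<Rightarrow> real \<Rightarrow> 'd::finite set \<Rightarrow> ('d \<Rightarrow> real) \<Rightarrow> ('d \<Rightarrow> real) \<Rightarrow>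
     (real ^ 'd ^ 'm) \<times> (real ^ 'd ^ 'n) \<Rightarrow> real" where
  "perturbed_objective F q p J l1 l2 = (\<lambda>(U, V). F (U ** transpose V)
     + (\<Sum>t\<in>J. l1 t / q * norm (column t U) powr q)
     + (\<Sum>t\<in>J. l2 t / p * norm (column t V) powr p))"


section \<open>The algorithm\<close>

text \<open>\<open>J k\<close> is the set of columns in use in iteration \<open>k\<close>. \<open>U' k\<close>, \<open>V' k\<close> are the outputs of the two
  inexact minimizations of iteration \<open>k\<close>, and \<open>U (Suc k)\<close>, \<open>V (Suc k)\<close> arise from them by the rank
  adjustment. \<open>lam 0\<close> is the initial regularization parameter and \<open>lam_min\<close> its lower limit
  (the subscript-zero lambda).

  Since \<open>0 - 1 = 0\<close> on the naturals, \<open>U (k - 1)\<close> encodes the convention that the iterate with index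
  \<open>-1\<close> equals the one with index \<open>0\<close>. The previous iterate may have columns deleted in the meantime;
  these are removed by \<open>keep_columns\<close>.

  The gradients are taken over the ambient matrix space: as \<open>V k\<close> and \<open>U' k\<close> vanish outside \<open>J k\<close>, so
  do these gradients, which are therefore the gradients over \<open>col_space (J k)\<close>.\<close>

definition extrapolate ::
    "'d set \<Rightarrow> real \<Rightarrow> (nat \<Rightarrow> real ^ 'd ^ 'm) \<Rightarrow> nat \<Rightarrow> real ^ 'd ^ 'm" where
  "extrapolate J b A k = keep_columns J (A k + b *\<^sub>R (A k - A (k - 1)))"

locale inexact_palm =
  fixes F :: "real ^ 'n::finite ^ 'm::finite \<Rightarrow> real"
    and q p :: real
    and lam_min rho beta_max :: real
    and lam L1 L2 delta beta :: "nat \<Rightarrow> real"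
    and lam1 lam2 :: "nat \<Rightarrow> 'd::finite \<Rightarrow> real"
    and J :: "nat \<Rightarrow> 'd set"
    and U U' :: "nat \<Rightarrow> real ^ 'd ^ 'm"
    and V V' :: "nat \<Rightarrow> real ^ 'd ^ 'n"
  assumes lam_min_pos: "0 < lam_min"
    and lam_init: "lam_min < lam 0"
    and rho: "0 < rho" "rho < 1"
    and beta_max: "0 \<le> beta_max"
    and L_pos: "0 < L1 k" "0 < L2 k"
    and delta_range: "0 \<le> delta k" "delta k \<le> 1/4"
    and delta_tendsto: "delta \<longlonglongrightarrow> 0"
    and delta_summable: "summable delta"
    and beta_range: "0 \<le> beta k" "beta k \<le> beta_max"
    and J_init: "J 0 = UNIV"
    and U'_cols: "U' k \<in> col_space (J k)"
    and V'_cols: "V' k \<in> col_space (J k)"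
    and lam12_pos: "t \<in> J k \<Longrightarrow> 0 < lam1 k t" "t \<in> J k \<Longrightarrow> 0 < lam2 k t"
    and U_step: "t \<in> J k \<Longrightarrow>
          column t (U' k) \<in> prox (\<lambda>u. lam1 k t / (q * L1 k) * norm u powr q)
            (column t (extrapolate (J k) (beta k) U k
               - (1 / L1 k) *\<^sub>R grad (\<lambda>A. F (A ** transpose (V k)))
                                   (extrapolate (J k) (beta k) U k)))"
    and V_step: "t \<in> J k \<Longrightarrow>
          column t (V' k) \<in> prox (\<lambda>v. lam2 k t / (p * L2 k) * norm v powr p)
            (column t (extrapolate (J k) (beta k) V k
               - (1 / L2 k) *\<^sub>R grad (\<lambda>B. F (U' k ** transpose B))
                                   (extrapolate (J k) (beta k) V k)))"
    and lam1_inexact: "t \<in> J k \<Longrightarrow> \<bar>(lam k / lam1 k t) powr (1 / (q + 1)) - 1\<bar> \<le> delta k"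
    and lam2_inexact: "t \<in> J k \<Longrightarrow> \<bar>(lam k / lam2 k t) powr (1 / (p + 1)) - 1\<bar> \<le> delta k"
    and lam_step: "lam (Suc k) = max (rho * lam k) lam_min"
    and J_step: "J (Suc k) = {t \<in> J k. column t (U' k) \<noteq> 0 \<and> column t (V' k) \<noteq> 0}"
    and U_adjust: "U (Suc k) = keep_columns (J (Suc k)) (U' k)"
    and V_adjust: "V (Suc k) = keep_columns (J (Suc k)) (V' k)"
begin

text \<open>The rank adjustment happens only finitely often.\<close>

lemma J_eventually_const: "\<exists>K. \<forall>k\<ge>K. J k = J K"
proof -
  have "decseq J"
    by (rule decseq_SucI) (auto simp: J_step)
  define K where "K = arg_min (\<lambda>k. card (J k)) (\<lambda>_. True)"
  have K: "card (J K) \<le> card (J k)" for k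
    unfolding K_def by (rule arg_min_nat_le) simp
  have "J k = J K" if "K \<le> k" for k
    using decseqD[OF \<open>decseq J\<close> that] K[of k] by (intro card_seteq) auto
  then show ?thesis by blast
qed

text \<open>From then on the adjustment does not change the computed matrices.\<close>

lemma adjust_const:
  assumes "J (Suc k) = J k"
  shows "U (Suc k) = U' k" "V (Suc k) = V' k"
  using U'_cols[of k] V'_cols[of k] assms
  by (auto simp: U_adjust V_adjust keep_columns_def col_space_def vec_eq_iff column_def)

end

end

theory Submission
  imports Defs
begin

text \<open>Optimality in the proximal step, compared with the previous iterate, and the descent lemma show
  that each block update decreases the perturbed objective by a multiple of the squared step, up to an
  extrapolation term that is dominated by the decrease of the previous update. Passing from the
  perturbed parameters of one iteration to those of the next costs at most a factor \<open>exp (err k)\<close> with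
  \<open>err\<close> summable, because \<open>lam\<close> is decreasing and \<open>lam1 k t\<close>, \<open>lam2 k t\<close> agree with \<open>lam k\<close> up to
  factors \<open>1 + O(delta k)\<close>. Hence the energy above the infimum of \<open>F\<close> stays bounded and the squared steps
  are summable; boundedness of the penalties bounds the iterates. Active columns never vanish after the
  last rank adjustment, so the prox inclusions become gradient equations, and these show that the
  gradients of the objective at the iterates tend to zero along convergent subsequences.\<close>

section \<open>Gradients, descent and proximal optimality\<close>

lemma GDERIV_unique:
  assumes "GDERIV f x :> a" "GDERIV f x :> b"
  shows "a = b"
proof -
  have "(\<lambda>h. inner h a) = (\<lambda>h. inner h b)"
    using assms unfolding gderiv_def by (rule has_derivative_unique)
  then have "inner h (a - b) = 0" for h
    by (metis inner_diff_right right_minus_eq)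
  then show ?thesis
    by (metis inner_eq_zero_iff right_minus_eq)
qed

lemma grad_eqI: "GDERIV f x :> g \<Longrightarrow> grad f x = g"
  unfolding grad_def by (rule the_equality) (auto intro: GDERIV_unique)

text \<open>\<open>grad\<close> is a definite description, so existence has to be supplied. This is
  Riesz representation: \<open>adjoint D 1\<close> represents the linear functional
  \<open>D\<close>.\<close>

lemma differentiable_imp_GDERIV_grad:
  fixes f :: "'a::euclidean_space \<Rightarrow> real"
  assumes "f differentiable (at x)"
  shows "GDERIV f x :> grad f x"
proof -
  obtain D where D: "(f has_derivative D) (at x)"
    using assms differentiable_def by blast
  have "D h = inner h (adjoint D 1)" for h
    using adjoint_works[of D h 1] has_derivative_linear[OF D] by (simp add: inner_commute)
  then have "D = (\<lambda>h. inner h (adjoint D 1))"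
    by blast
  then have "GDERIV f x :> adjoint D 1"
    using D by (simp add: gderiv_def)
  then show ?thesis
    using grad_eqI by metis
qed

text \<open>Only the segment from \<open>x\<close> to \<open>y\<close> enters, so the Lipschitz
  bound on a convex \<open>S\<close> is enough. This suits block gradients that are known to be
  Lipschitz only on \<open>col_space J\<close>.\<close>

lemma descent_lemma_upper:
  fixes f :: "'a::real_inner \<Rightarrow> real"
  assumes "convex S" and "x \<in> S" and "y \<in> S"
    and D: "\<And>z. z \<in> S \<Longrightarrow> GDERIV f z :> g z"
    and lip: "C-lipschitz_on S g"
  shows "f y \<le> f x + inner (g x) (y - x) + C / 2 * (norm (y - x))\<^sup>2"
proof -
  define d where "d = y - x"
  \<comment> \<open>Along the segment, \<open>h\<close> is \<open>f\<close> minus its claimed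
    quadratic upper bound, up to the constant \<open>f x\<close>. Cauchy-Schwarz and the Lipschitz
    condition make its derivative nonpositive.\<close>
  define h where "h s = f (x + s *\<^sub>R d) - s * inner (g x) d - C / 2 * s\<^sup>2 * (norm d)\<^sup>2" for s :: real
  have S: "x + s *\<^sub>R d \<in> S" if "0 \<le> s" "s \<le> 1" for s
    using convexD_alt[OF assms(1-3) that] by (simp add: d_def algebra_simps)
  have "h 1 \<le> h 0"
  proof (rule DERIV_nonpos_imp_nonincreasing[of 0 1])
    fix s :: real assume s: "0 \<le> s" "s \<le> 1"
    let ?z = "x + s *\<^sub>R d"
    have "((\<lambda>s. x + s *\<^sub>R d) has_derivative (\<lambda>s. s *\<^sub>R d)) (at s)"
      by (auto intro!: derivative_eq_intros)
    then have "((\<lambda>s. f (x + s *\<^sub>R d)) has_derivative (\<lambda>r. inner (r *\<^sub>R d) (g ?z))) (at s)"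
      using D[OF S[OF s]] unfolding gderiv_def by (rule has_derivative_compose)
    then have f: "((\<lambda>s. f (x + s *\<^sub>R d)) has_real_derivative inner (g ?z) d) (at s)"
      by (simp add: has_field_derivative_def inner_commute mult_commute_abs)
    have "(h has_real_derivative inner (g ?z) d - inner (g x) d - C * s * (norm d)\<^sup>2) (at s)"
      unfolding h_def by (rule derivative_eq_intros f refl | simp)+
    moreover have "inner (g ?z) d - inner (g x) d \<le> C * s * (norm d)\<^sup>2"
    proof -
      have "inner (g ?z - g x) d \<le> norm (g ?z - g x) * norm d"
        by (rule norm_cauchy_schwarz)
      also have "\<dots> \<le> (C * norm (s *\<^sub>R d)) * norm d"
        using lipschitz_onD[OF lip S[OF s] assms(2)]
        by (intro mult_right_mono) (auto simp: dist_norm)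
      finally show ?thesis
        using s by (simp add: inner_diff_left power2_eq_square)
    qed
    ultimately show "\<exists>y. (h has_real_derivative y) (at s) \<and> y \<le> 0"
      by (intro exI conjI) auto
  qed simp
  then show ?thesis
    by (simp add: h_def d_def)
qed

text \<open>Differentiability makes the quotient in the definition tend to 0 along \<open>S\<close>,
  which gives the bound on the Liminf; \<open>w\<close> itself must lie in \<open>S\<close> because
  the subdifferential is taken inside that subspace.\<close>

lemma GDERIV_imp_frechet_subdifferential:
  assumes "GDERIV f x :> w" and "w \<in> S"
  shows "w \<in> frechet_subdifferential S f x"
proof -
  have "(f has_derivative (\<lambda>h. inner h w)) (at x within S)"
    using assms(1) by (simp add: gderiv_def has_derivative_at_withinI)
  then have "((\<lambda>y. (f y - f x - inner w (y - x)) / norm (y - x)) \<longlongrightarrow> 0) (at x within S)"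
    unfolding has_derivative_iff_norm inner_commute[of w]
    by (subst tendsto_norm_zero_iff[symmetric]) simp
  then have "\<forall>\<^sub>F y in at x within S. c < ereal ((f y - f x - inner w (y - x)) / norm (y - x))"
    if "c < 0" for c :: ereal
    using that order_tendstoD(1)[of "\<lambda>y. ereal ((f y - f x - inner w (y - x)) / norm (y - x))" "ereal 0"]
    by (auto simp: zero_ereal_def)
  then show ?thesis
    using assms(2) by (auto simp: frechet_subdifferential_def le_Liminf_iff)
qed

lemma GDERIV_norm_powr:
  fixes u :: "'a::real_inner"
  assumes "u \<noteq> 0"
  shows "GDERIV (\<lambda>u. norm u powr q) u :> (q * norm u powr (q - 2)) *\<^sub>R u"
proof -
  have "GDERIV (\<lambda>u. norm u powr q) u :> (q * norm u powr (q - 1)) *\<^sub>R sgn u"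
    by (rule GDERIV_DERIV_compose[OF GDERIV_norm[OF assms]])
       (use assms in \<open>auto intro!: derivative_eq_intros simp: powr_diff\<close>)
  moreover have "norm u powr (q - 1) / norm u = norm u powr (q - 2)"
    using assms by (simp add: powr_diff power2_eq_square)
  ultimately show ?thesis
    by (simp add: sgn_div_norm divide_inverse mult.assoc)
qed

text \<open>Away from the origin the power of the norm is differentiable even for exponents below 1,
  so Fermat's rule turns the prox inclusion into an equation.\<close>

lemma prox_norm_powr_stationary:
  fixes x y :: "'a::real_inner"
  assumes "y \<in> prox (\<lambda>u. c * norm u powr q) x" and "y \<noteq> 0"
  shows "y - x + (c * q * norm y powr (q - 2)) *\<^sub>R y = 0" (is "?g = 0")
proof -
  let ?h = "\<lambda>u. 1/2 * (norm (u - x))\<^sup>2 + c * norm u powr q"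
  have min: "?h y \<le> ?h u" for u
    using assms(1) by (auto simp: prox_def is_arg_min_def not_less)
  have 1: "((\<lambda>u. norm u powr q) has_derivative (\<lambda>h. inner h ((q * norm y powr (q - 2)) *\<^sub>R y))) (at y)"
    using GDERIV_norm_powr[OF assms(2), of q] by (simp add: gderiv_def)
  have 2: "((\<lambda>u. (norm (u - x))\<^sup>2) has_derivative (\<lambda>h. 2 * inner h (y - x))) (at y)"
    unfolding power2_norm_eq_inner
    by (rule derivative_eq_intros refl | simp)+ (simp add: fun_eq_iff inner_commute)
  have "(?h has_derivative
      (\<lambda>h. 1/2 * (2 * inner h (y - x)) + c * inner h ((q * norm y powr (q - 2)) *\<^sub>R y))) (at y)"
    by (intro has_derivative_add has_derivative_mult_right 1 2)
  then have "(?h has_derivative (\<lambda>h. inner h ?g)) (at y)"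
    by (simp add: inner_add_right algebra_simps)
  then have "(\<lambda>h. inner h ?g) = (\<lambda>h. 0)"
    by (rule has_derivative_local_min) (intro always_eventually allI min)
  then show ?thesis
    by (metis inner_eq_zero_iff)
qed

section \<open>Matrices by columns\<close>

lemma inner_matrix_columns:
  fixes A B :: "real ^ 'd ^ 'm"
  shows "inner A B = (\<Sum>t\<in>UNIV. inner (column t A) (column t B))"
  by (simp add: inner_vec_def column_def) (rule sum.swap)

lemma column_simps:
  fixes A B :: "real ^ 'd ^ 'm"
  shows "column t (A + B) = column t A + column t B"
    and "column t (A - B) = column t A - column t B"
    and "column t (c *\<^sub>R A) = c *\<^sub>R column t A"
    and "column t (0 :: real ^ 'd ^ 'm) = 0"
  by (simp_all add: column_def vec_eq_iff)

lemma bounded_linear_column: "bounded_linear (column t :: real ^ 'd ^ 'm \<Rightarrow> real ^ 'm)"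
  unfolding linear_conv_bounded_linear[symmetric] by (rule linearI) (simp_all add: column_simps)

lemma col_space_subspace: "subspace (col_space J :: (real ^ 'd ^ 'm) set)"
  by (auto simp: subspace_def col_space_def column_simps)

lemma inner_col_space:
  fixes A B :: "real ^ 'd ^ 'm"
  assumes "A \<in> col_space J"
  shows "inner A B = (\<Sum>t\<in>J. inner (column t A) (column t B))"
  unfolding inner_matrix_columns
  by (rule sum.mono_neutral_right) (use assms in \<open>auto simp: col_space_def\<close>)

lemma norm_col_space:
  fixes A :: "real ^ 'd ^ 'm"
  assumes "A \<in> col_space J"
  shows "(norm A)\<^sup>2 = (\<Sum>t\<in>J. (norm (column t A))\<^sup>2)"
  by (simp add: power2_norm_eq_inner inner_col_space[OF assms])

lemma keep_columns_col_space: "A \<in> col_space J \<Longrightarrow> keep_columns J A = A"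
  by (auto simp: keep_columns_def col_space_def vec_eq_iff column_def)

lemma keep_columns_in_col_space: "keep_columns J A \<in> col_space J"
  by (auto simp: keep_columns_def col_space_def vec_eq_iff column_def)

section \<open>Calculus of the product \<open>A ** transpose B\<close>\<close>

lemma bounded_bilinear_matrix_mult:
  "bounded_bilinear (\<lambda>(A :: real ^ 'd ^ 'm) (B :: real ^ 'n ^ 'd). A ** B)"
  unfolding bilinear_conv_bounded_bilinear[symmetric] bilinear_def
  by (auto intro!: linearI simp: matrix_matrix_mult_def vec_eq_iff
      sum.distrib sum_distrib_left algebra_simps)

lemma bounded_linear_transpose: "bounded_linear (transpose :: real ^ 'd ^ 'm \<Rightarrow> real ^ 'm ^ 'd)"
  unfolding linear_conv_bounded_linear[symmetric]
  by (rule linearI) (simp_all add: transpose_def vec_eq_iff)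

lemmas bounded_bilinear_mult_transpose =
  bounded_bilinear.comp[OF bounded_bilinear_matrix_mult bounded_linear_ident bounded_linear_transpose]

lemmas tendsto_matrix_mult = bounded_bilinear.tendsto[OF bounded_bilinear_matrix_mult]

lemmas tendsto_transpose = bounded_linear.tendsto[OF bounded_linear_transpose]

text \<open>Adjoint identity for the Frobenius inner product; with its mirror image below it puts
  the gradient of \<open>F (A ** transpose B)\<close> into matrix form.\<close>

lemma inner_mult_transpose_left:
  fixes A :: "real ^ 'd ^ 'm" and B :: "real ^ 'd ^ 'n"
  shows "inner (A ** transpose B) H = inner A (H ** B)"
proof -
  have "(\<Sum>j\<in>UNIV. \<Sum>t\<in>UNIV. A $ i $ t * B $ j $ t * H $ i $ j)
      = (\<Sum>t\<in>UNIV. \<Sum>j\<in>UNIV. A $ i $ t * (H $ i $ j * B $ j $ t))" for i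
    by (subst sum.swap) (simp add: ac_simps)
  then show ?thesis
    by (simp add: matrix_matrix_mult_def transpose_def inner_vec_def sum_distrib_left sum_distrib_right)
qed

lemma inner_mult_transpose_right:
  fixes A :: "real ^ 'd ^ 'm" and B :: "real ^ 'd ^ 'n"
  shows "inner (A ** transpose B) H = inner B (transpose H ** A)"
proof -
  have "inner (A ** transpose B) H = inner (transpose (A ** transpose B)) (transpose H)"
    by (simp add: inner_vec_def transpose_def) (rule sum.swap)
  also have "\<dots> = inner (B ** transpose A) (transpose H)"
    by (simp add: matrix_transpose_mul)
  finally show ?thesis
    by (simp add: inner_mult_transpose_left)
qed

lemma GDERIV_mult_transpose:
  fixes F :: "real ^ 'n ^ 'm \<Rightarrow> real" and A :: "real ^ 'd ^ 'm" and B :: "real ^ 'd ^ 'n"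
  assumes "F differentiable (at (A ** transpose B))"
  shows "GDERIV (\<lambda>(A, B). F (A ** transpose B)) (A, B) :>
    (grad F (A ** transpose B) ** B, transpose (grad F (A ** transpose B)) ** A)"
proof -
  let ?H = "grad F (A ** transpose B)"
  have 1: "(F has_derivative (\<lambda>h. inner h ?H)) (at (fst (A, B) ** transpose (snd (A, B))))"
    using differentiable_imp_GDERIV_grad[OF assms] by (simp add: gderiv_def)
  have "((\<lambda>Z. fst Z ** transpose (snd Z)) has_derivative
      (\<lambda>h. A ** transpose (snd h) + fst h ** transpose B)) (at (A, B))"
    using bounded_bilinear.FDERIV[OF bounded_bilinear_mult_transpose
        has_derivative_fst[OF has_derivative_ident] has_derivative_snd[OF has_derivative_ident]]
    by force
  from has_derivative_compose[OF this 1] show ?thesis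
    by (simp only: gderiv_def case_prod_unfold inner_add_left inner_mult_transpose_left[of _ B]
        inner_mult_transpose_right[of A] inner_prod_def add.commute fst_conv snd_conv)
qed

lemma GDERIV_partial:
  fixes f :: "'a::real_inner \<times> 'b::real_inner \<Rightarrow> real"
  assumes "GDERIV f (A, B) :> (a, b)"
  shows "GDERIV (\<lambda>A. f (A, B)) A :> a" "GDERIV (\<lambda>B. f (A, B)) B :> b"
proof -
  have f: "(f has_derivative (\<lambda>h. inner h (a, b))) (at (A, B))"
    using assms by (simp add: gderiv_def)
  have "((\<lambda>A. (A, B)) has_derivative (\<lambda>h. (h, 0))) (at A)"
       "((\<lambda>B. (A, B)) has_derivative (\<lambda>h. (0, h))) (at B)"
    by (auto intro!: derivative_eq_intros)
  from this[THEN has_derivative_compose, OF f]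
  show "GDERIV (\<lambda>A. f (A, B)) A :> a" "GDERIV (\<lambda>B. f (A, B)) B :> b"
    by (simp_all add: gderiv_def)
qed

section \<open>One block step\<close>

text \<open>Completing the square: \<open>c\<close> times the prox objective of a column differs
  from that column's share of the linearized block objective by a constant. The block objective
  separates over the active columns, so the column inequalities add up.\<close>

lemma block_prox_le:
  fixes A X Y G :: "real ^ 'd ^ 'm"
  assumes "A \<in> col_space J" "X \<in> col_space J" "Y \<in> col_space J" and "c > 0"
    and prox: "\<And>t. t \<in> J \<Longrightarrow> column t Y \<in> prox (\<lambda>u. l t / (q * c) * norm u powr q)
                 (column t (X - (1 / c) *\<^sub>R G))"
  shows "c / 2 * (norm (Y - X))\<^sup>2 + inner (Y - X) G + (\<Sum>t\<in>J. l t / q * norm (column t Y) powr q)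
    \<le> c / 2 * (norm (A - X))\<^sup>2 + inner (A - X) G + (\<Sum>t\<in>J. l t / q * norm (column t A) powr q)"
proof -
  define h where "h t u = c / 2 * (norm (u - column t X))\<^sup>2 + inner (u - column t X) (column t G)
    + l t / q * norm u powr q" for t and u :: "real ^ 'm"
  have h: "h t (column t Y) \<le> h t (column t A)" if "t \<in> J" for t
  proof -
    let ?x = "column t (X - (1 / c) *\<^sub>R G)"
    have expand: "c * (1/2 * (norm (u - ?x))\<^sup>2 + l t / (q * c) * norm u powr q)
        = h t u + (norm (column t G))\<^sup>2 / (2 * c)" for u
    proof -
      have "(norm (u - ?x))\<^sup>2 = (norm (u - column t X))\<^sup>2
          + 2 / c * inner (u - column t X) (column t G) + (norm (column t G))\<^sup>2 / c\<^sup>2"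
        using dot_norm[of "u - column t X" "(1 / c) *\<^sub>R column t G"] \<open>c > 0\<close>
        by (simp add: column_simps algebra_simps power_divide)
      then show ?thesis
        using \<open>c > 0\<close> by (simp add: h_def field_simps power2_eq_square)
    qed
    have "1/2 * (norm (column t Y - ?x))\<^sup>2 + l t / (q * c) * norm (column t Y) powr q
        \<le> 1/2 * (norm (column t A - ?x))\<^sup>2 + l t / (q * c) * norm (column t A) powr q"
      using prox[OF that] by (auto simp: prox_def is_arg_min_def not_less)
    from mult_left_mono[OF this, of c] show ?thesis
      using \<open>c > 0\<close> unfolding expand by simp
  qed
  have "(\<Sum>t\<in>J. h t (column t Z)) = c / 2 * (norm (Z - X))\<^sup>2 + inner (Z - X) G
      + (\<Sum>t\<in>J. l t / q * norm (column t Z) powr q)" if "Z \<in> col_space J" for Z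
  proof -
    have "Z - X \<in> col_space J"
      using that assms(2) by (rule subspace_diff[OF col_space_subspace])
    then show ?thesis
      by (simp add: h_def norm_col_space inner_col_space sum.distrib sum_distrib_left column_simps)
  qed
  with sum_mono[of J "\<lambda>t. h t (column t Y)" "\<lambda>t. h t (column t A)", OF h] assms(1,3)
  show ?thesis by simp
qed

text \<open>The extrapolation error \<open>A - X\<close> enters with total weight \<open>c\<close>; the bound on \<open>b\<close> makes it
  smaller than the decrease \<open>c / 8\<close> gained in the previous step.\<close>

lemma block_descent:
  fixes f :: "real ^ 'd ^ 'm \<Rightarrow> real" and A B Y :: "real ^ 'd ^ 'm"
  assumes D: "\<And>Z. GDERIV f Z :> grad f Z"
    and lip: "(c / 2)-lipschitz_on (col_space J) (grad f)"
    and cols: "A \<in> col_space J" "B \<in> col_space J" "Y \<in> col_space J"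
    and "c > 0" and X: "X = A + b *\<^sub>R (A - B)" and b: "c * b\<^sup>2 \<le> c' / 36"
    and prox: "\<And>t. t \<in> J \<Longrightarrow> column t Y \<in> prox (\<lambda>u. l t / (q * c) * norm u powr q)
                 (column t (X - (1 / c) *\<^sub>R grad f X))"
  shows "f Y + (\<Sum>t\<in>J. l t / q * norm (column t Y) powr q) + c / 8 * (norm (Y - A))\<^sup>2
    \<le> f A + (\<Sum>t\<in>J. l t / q * norm (column t A) powr q) + c' / 36 * (norm (A - B))\<^sup>2"
proof -
  have X_col: "X \<in> col_space J"
    unfolding X using cols
    by (intro subspace_add subspace_scale subspace_diff col_space_subspace)
  have convex: "convex (col_space J :: (real ^ 'd ^ 'm) set)"
    by (rule subspace_imp_convex[OF col_space_subspace])
  have up: "f Y \<le> f X + inner (grad f X) (Y - X) + c / 2 / 2 * (norm (Y - X))\<^sup>2"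
    by (rule descent_lemma_upper[OF convex X_col cols(3) D lip])
  \<comment> \<open>Applied to \<open>- f\<close>: since \<open>f\<close> need not be convex, its
    linearization at \<open>X\<close> may exceed \<open>f A\<close>, but by no more than this
    quadratic term.\<close>
  have "- f A \<le> - f X + inner (- grad f X) (A - X) + c / 2 / 2 * (norm (A - X))\<^sup>2"
    by (rule descent_lemma_upper[OF convex X_col cols(1) GDERIV_minus[OF D]])
       (use lip in \<open>simp add: lipschitz_on_def dist_minus\<close>)
  then have low: "f X + inner (grad f X) (A - X) \<le> f A + c / 4 * (norm (A - X))\<^sup>2"
    by simp
  \<comment> \<open>Balance of weights on squared norms: the prox comparison gives
    \<open>c / 2\<close> on \<open>Y - X\<close>, of which \<open>up\<close> consumes
    \<open>c / 4\<close>; the rest, with another \<open>c / 4\<close> on \<open>A - X\<close>, pays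
    for \<open>c / 8\<close> on \<open>Y - A\<close>. In total \<open>A - X\<close> carries
    \<open>c / 2 + c / 4 + c / 4 = c\<close>.\<close>
  have "norm (Y - A) \<le> norm (Y - X) + norm (A - X)"
    using norm_triangle_ineq4[of "Y - X" "A - X"] by simp
  then have "(norm (Y - A))\<^sup>2 \<le> (norm (Y - X) + norm (A - X))\<^sup>2"
    by (simp add: power_mono)
  also have "\<dots> \<le> 2 * (norm (Y - X))\<^sup>2 + 2 * (norm (A - X))\<^sup>2"
    using sum_squares_bound[of "norm (Y - X)" "norm (A - X)"] by (simp add: power2_sum)
  finally have "c / 8 * (norm (Y - A))\<^sup>2 \<le> c / 8 * (2 * (norm (Y - X))\<^sup>2 + 2 * (norm (A - X))\<^sup>2)"
    using \<open>c > 0\<close> by (intro mult_left_mono) auto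
  moreover have "c * (norm (A - X))\<^sup>2 \<le> c' / 36 * (norm (A - B))\<^sup>2"
    using mult_right_mono[OF b, of "(norm (A - B))\<^sup>2"] by (simp add: X power_mult_distrib)
  moreover note block_prox_le[OF cols(1) X_col cols(3) \<open>c > 0\<close> prox]
  ultimately show ?thesis
    using up low by (simp add: inner_commute algebra_simps)
qed

text \<open>Multiplying the prox equation by \<open>c\<close> isolates the penalty gradient of the
  column; the right side consists of \<open>G\<close> and a multiple of \<open>Y - X\<close>, both
  controllable along the sequence.\<close>

lemma block_stationary:
  fixes X Y G :: "real ^ 'd ^ 'm"
  assumes "c > 0" "q > 0" and "column t Y \<noteq> 0"
    and "column t Y \<in> prox (\<lambda>u. l / (q * c) * norm u powr q) (column t (X - (1 / c) *\<^sub>R G))"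
  shows "(l * norm (column t Y) powr (q - 2)) *\<^sub>R column t Y = - column t (G + c *\<^sub>R (Y - X))"
proof -
  have "column t Y - (column t X - (1 / c) *\<^sub>R column t G)
      + (l / c * norm (column t Y) powr (q - 2)) *\<^sub>R column t Y = 0"
    using prox_norm_powr_stationary[OF assms(4,3)] assms(2) by (simp add: column_simps)
  then have "c *\<^sub>R (column t Y - (column t X - (1 / c) *\<^sub>R column t G)
      + (l / c * norm (column t Y) powr (q - 2)) *\<^sub>R column t Y) = 0"
    by simp
  then show ?thesis
    using assms(1) by (simp add: column_simps algebra_simps add_eq_0_iff)
qed

section \<open>Perturbed parameters and quasi-descent\<close>

text \<open>In use, \<open>a\<close> is \<open>lam k\<close>, \<open>b\<close> a perturbed parameter
  and \<open>r\<close> is \<open>q + 1\<close> or \<open>p + 1\<close>. Raising to the power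
  \<open>r\<close> undoes the root in the inexactness criterion.\<close>

lemma powr_ratio_bounds:
  fixes a b :: real
  assumes "0 < a" "0 < b" "r > 0" "\<bar>(a / b) powr (1 / r) - 1\<bar> \<le> d" "d < 1"
  shows "(1 - d) powr r * b \<le> a" "a \<le> (1 + d) powr r * b"
proof -
  have r: "((a / b) powr (1 / r)) powr r = a / b"
    using assms by (simp add: powr_powr)
  have "(1 - d) powr r \<le> ((a / b) powr (1 / r)) powr r"
    using assms by (intro powr_mono2) auto
  moreover have "((a / b) powr (1 / r)) powr r \<le> (1 + d) powr r"
    using assms by (intro powr_mono2) auto
  ultimately show "(1 - d) powr r * b \<le> a" "a \<le> (1 + d) powr r * b"
    using assms unfolding r by (simp_all add: field_simps)
qed

lemma powr_ratio_tendsto_1: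
  fixes b d :: "nat \<Rightarrow> real"
  assumes "a \<longlonglongrightarrow> x" "x > 0" "\<And>k. 0 < a k" "\<And>k. 0 < b k" "r > 0"
    "\<And>k. \<bar>(a k / b k) powr (1 / r) - 1\<bar> \<le> d k" "d \<longlonglongrightarrow> 0"
  shows "b \<longlonglongrightarrow> x"
proof -
  have "(\<lambda>k. (a k / b k) powr (1 / r) - 1) \<longlonglongrightarrow> 0"
    by (rule tendsto_0_le[OF assms(7), of _ 1]) (use assms(6) in \<open>auto intro!: always_eventually intro: order_trans[OF _ abs_ge_self]\<close>)
  then have "(\<lambda>k. (a k / b k) powr (1 / r)) \<longlonglongrightarrow> 1"
    using LIM_zero_iff by blast
  then have "(\<lambda>k. ((a k / b k) powr (1 / r)) powr r) \<longlonglongrightarrow> 1 powr r"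
    by (intro tendsto_powr) auto
  then have "(\<lambda>k. a k / b k) \<longlonglongrightarrow> 1"
    using assms by (simp add: powr_powr less_imp_le)
  from tendsto_divide[OF assms(1) this] show ?thesis
    using assms(3,4) by (simp add: less_imp_neq[symmetric])
qed

text \<open>The deterministic Robbins-Siegmund argument: dividing by the partial products of
  \<open>exp (e i)\<close> makes \<open>a\<close> decreasing.\<close>

lemma quasi_descent_summable:
  fixes a b e :: "nat \<Rightarrow> real"
  assumes a: "\<And>k. 0 \<le> a k" and b: "\<And>k. 0 \<le> b k" and e: "\<And>k. 0 \<le> e k" and "summable e"
    and step: "\<And>k. a (Suc k) + b k \<le> exp (e k) * a k"
  shows "a k \<le> exp (suminf e) * a 0" and "summable b"
proof -
  define P where "P k = exp (- (\<Sum>i<k. e i))" for k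
  have P_Suc: "P (Suc k) * exp (e k) = P k" for k
    by (simp add: P_def flip: exp_add)
  have P_ge: "exp (- suminf e) \<le> P k" for k
    using sum_le_suminf[OF \<open>summable e\<close>, of "{..<k}"] e by (simp add: P_def)
  \<comment> \<open>The weighted steps telescope by \<open>P_Suc\<close>. The uniform lower bound
    \<open>P_ge\<close> on the weights lets the partial sums of \<open>b\<close> be carried along
    unweighted.\<close>
  have decr: "P k * a k + exp (- suminf e) * (\<Sum>i<k. b i) \<le> a 0" for k
  proof (induction k)
    case 0
    then show ?case by (simp add: P_def)
  next
    case (Suc k)
    have "P (Suc k) * (a (Suc k) + b k) \<le> P (Suc k) * (exp (e k) * a k)"
      by (rule mult_left_mono[OF step]) (simp add: P_def)
    then have "P (Suc k) * a (Suc k) + P (Suc k) * b k \<le> P k * a k"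
      by (simp add: P_Suc[of k, symmetric] algebra_simps)
    moreover have "exp (- suminf e) * b k \<le> P (Suc k) * b k"
      by (rule mult_right_mono[OF P_ge b])
    ultimately show ?case
      using Suc.IH by (simp add: algebra_simps)
  qed
  have "exp (- suminf e) * a k \<le> a 0" for k
    using mult_right_mono[OF P_ge a, of k k] decr[of k] b
    by (smt (verit) mult_nonneg_nonneg exp_ge_zero sum_nonneg)
  from this[of k] show "a k \<le> exp (suminf e) * a 0"
    by (simp add: exp_minus field_simps)
  have "exp (- suminf e) * (\<Sum>i<k. b i) \<le> a 0" for k
    using decr[of k] mult_nonneg_nonneg[OF _ a[of k], of "P k"] by (simp add: P_def)
  then have "(\<Sum>i<k. b i) \<le> exp (suminf e) * a 0" for k
    by (simp add: exp_minus field_simps)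
  then show "summable b"
    by (rule summableI_nonneg_bounded[OF b])
qed

text \<open>The bound 3 on \<open>r\<close> comes from exponents at most 2. It gives
  \<open>(1 + d) powr r \<le> exp (3 * d)\<close>, where \<open>3 * d\<close> is below 1, and
  \<open>-ln (1 - d') \<le> 2 * d'\<close> gives
  \<open>exp (- (6 * d')) \<le> (1 - d') powr r\<close>. Chaining both through
  \<open>a' \<le> a\<close> compares \<open>b'\<close> with \<open>b\<close>.\<close>

lemma powr_ratio_step:
  fixes a a' b b' :: real
  assumes "0 < a'" "a' \<le> a" "0 < b" "0 < b'" "0 < r" "r \<le> 3"
    and d: "\<bar>(a / b) powr (1 / r) - 1\<bar> \<le> d" "0 \<le> d" "d \<le> 1/4"
    and d': "\<bar>(a' / b') powr (1 / r) - 1\<bar> \<le> d'" "0 \<le> d'" "d' \<le> 1/4"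
  shows "a \<le> exp 1 * b" "b' \<le> exp (3 * (d + 2 * d')) * b"
proof -
  have "r * ln (1 + d) \<le> 3 * d"
    using assms(5,6) d ln_add_one_self_le_self[of d] by (intro mult_mono) auto
  then have "(1 + d) powr r \<le> exp (3 * d)"
    using d by (simp add: powr_def)
  then have up: "a \<le> exp (3 * d) * b"
    using powr_ratio_bounds(2)[of a b r d] assms(1-5) d
      mult_right_mono[of "(1 + d) powr r" "exp (3 * d)" b] by linarith
  have "exp (3 * d) \<le> exp 1"
    using d by simp
  from mult_right_mono[OF this, of b] up \<open>0 < b\<close> show "a \<le> exp 1 * b"
    by linarith
  have "- d' - 2 * d'\<^sup>2 \<le> ln (1 - d')"
    using d' by (intro ln_one_minus_pos_lower_bound) auto
  moreover have "2 * d'\<^sup>2 \<le> d'"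
    using d' mult_right_mono[of "2 * d'" 1 d'] by (simp add: power2_eq_square)
  ultimately have "- ln (1 - d') \<le> 2 * d'"
    by linarith
  then have "r * (- ln (1 - d')) \<le> 3 * (2 * d')"
    using assms(5,6) d' by (intro mult_mono) auto
  then have "exp (- (6 * d')) \<le> (1 - d') powr r"
    using d' by (simp add: powr_def)
  then have "exp (- (6 * d')) * b' \<le> a'"
    using powr_ratio_bounds(1)[of a' b' r d'] assms(1-5) d'
      mult_right_mono[of "exp (- (6 * d'))" "(1 - d') powr r" b'] by linarith
  then have "exp (- (6 * d')) * b' \<le> exp (3 * d) * b"
    using up assms(2) by linarith
  from mult_left_mono[OF this, of "exp (6 * d')"] show "b' \<le> exp (3 * (d + 2 * d')) * b"
    by (simp add: mult.assoc[symmetric] distrib_left add.commute flip: exp_add)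
qed

text \<open>Coercivity of the penalty: nonnegative summands are each at most \<open>M\<close>,
  inverting the power bounds every active column, and at most \<open>card J\<close> columns
  contribute to the Frobenius norm.\<close>

lemma penalty_bound:
  fixes A :: "real ^ 'd ^ 'm"
  assumes "A \<in> col_space J" "c > 0" "q > 0" "\<And>t. t \<in> J \<Longrightarrow> c \<le> l t"
    and M: "(\<Sum>t\<in>J. l t / q * norm (column t A) powr q) \<le> M"
  shows "(norm A)\<^sup>2 \<le> card J * ((q * M / c) powr (1 / q))\<^sup>2"
proof -
  have "norm (column t A) \<le> (q * M / c) powr (1 / q)" if t: "t \<in> J" for t
  proof -
    have nonneg: "0 \<le> l s / q * norm (column s A) powr q" if "s \<in> J" for s
      using assms(2,3) assms(4)[OF that] by simp
    have "c / q * norm (column t A) powr q \<le> l t / q * norm (column t A) powr q"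
      using assms(3) assms(4)[OF t] by (intro mult_right_mono divide_right_mono) auto
    also have "\<dots> \<le> (\<Sum>t\<in>J. l t / q * norm (column t A) powr q)"
      by (rule member_le_sum[OF t]) (blast intro: nonneg, simp)
    finally have "c / q * norm (column t A) powr q \<le> M"
      using M by linarith
    then have "norm (column t A) powr q \<le> q * M / c"
      using assms(2,3) by (simp add: field_simps)
    then have "(norm (column t A) powr q) powr (1 / q) \<le> (q * M / c) powr (1 / q)"
      using assms(3) by (intro powr_mono2) auto
    then show ?thesis
      using assms(3) by (simp add: powr_powr)
  qed
  then have "(\<Sum>t\<in>J. (norm (column t A))\<^sup>2) \<le> (\<Sum>t\<in>J. ((q * M / c) powr (1 / q))\<^sup>2)"
    by (intro sum_mono power_mono) auto
  then show ?thesis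
    by (simp add: norm_col_space[OF assms(1)])
qed

section \<open>Gradient of the objective\<close>

definition penalty_grad :: "real \<Rightarrow> real \<Rightarrow> 'd set \<Rightarrow> real ^ 'd ^ 'm \<Rightarrow> real ^ 'd ^ 'm" where
  "penalty_grad q l J A =
     (\<chi> i t. if t \<in> J then l * norm (column t A) powr (q - 2) * A $ i $ t else 0)"

lemma column_penalty_grad:
  "column t (penalty_grad q l J A) =
     (if t \<in> J then (l * norm (column t A) powr (q - 2)) *\<^sub>R column t A else 0)"
  by (simp add: penalty_grad_def column_def vec_eq_iff)

lemma GDERIV_penalty:
  fixes A :: "real ^ 'd ^ 'm"
  assumes "q \<noteq> 0" and "\<And>t. t \<in> J \<Longrightarrow> column t A \<noteq> 0"
  shows "GDERIV (\<lambda>A. l / q * (\<Sum>t\<in>J. norm (column t A) powr q)) A :> penalty_grad q l J A"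
proof -
  let ?g = "\<lambda>t. (q * norm (column t A) powr (q - 2)) *\<^sub>R column t A"
  have "((\<lambda>A. norm (column t A) powr q) has_derivative (\<lambda>h. inner (column t h) (?g t))) (at A)"
    if "t \<in> J" for t
    using has_derivative_compose[OF bounded_linear_imp_has_derivative[OF bounded_linear_column]
        GDERIV_norm_powr[OF assms(2)[OF that], unfolded gderiv_def]] .
  then have "((\<lambda>A. l / q * (\<Sum>t\<in>J. norm (column t A) powr q)) has_derivative
      (\<lambda>h. l / q * (\<Sum>t\<in>J. inner (column t h) (?g t)))) (at A)"
    by (intro has_derivative_mult_right has_derivative_sum)
  moreover have "l / q * (\<Sum>t\<in>J. inner (column t h) (?g t)) = inner h (penalty_grad q l J A)" for h
  proof -
    have "inner h (penalty_grad q l J A) = inner (penalty_grad q l J A) h"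
      by (rule inner_commute)
    also have "\<dots> = (\<Sum>t\<in>J. inner (column t (penalty_grad q l J A)) (column t h))"
      by (rule inner_col_space) (simp add: col_space_def column_penalty_grad)
    finally show ?thesis
      using assms(1) by (simp add: column_penalty_grad sum_distrib_left inner_commute mult.assoc)
  qed
  ultimately show ?thesis
    by (simp add: gderiv_def)
qed

text \<open>Stationarity bounds \<open>l j t * norm (column t (Y j)) powr (q - 1)\<close> along the sequence, so
  replacing \<open>l j t\<close> by its limit changes the gradient by a null sequence even if \<open>q < 1\<close> and
  the column tends to zero.\<close>

lemma block_gradient_tendsto_0:
  fixes X Y G G' :: "nat \<Rightarrow> real ^ 'd ^ 'm"
  assumes "Y \<longlonglongrightarrow> Z" "X \<longlonglongrightarrow> Z" "G \<longlonglongrightarrow> H" "G' \<longlonglongrightarrow> H"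
    and c: "\<And>j. \<bar>c j\<bar> \<le> C"
    and l: "\<And>t. t \<in> J \<Longrightarrow> (\<lambda>j. l j t) \<longlonglongrightarrow> l0" "l0 > 0" "\<And>j t. t \<in> J \<Longrightarrow> 0 < l j t"
    and stat: "\<And>j t. t \<in> J \<Longrightarrow> (l j t * norm (column t (Y j)) powr (q - 2)) *\<^sub>R column t (Y j)
       = - column t (G j + c j *\<^sub>R (Y j - X j))"
    and G': "\<And>j. G' j \<in> col_space J"
  shows "(\<lambda>j. G' j + penalty_grad q l0 J (Y j)) \<longlonglongrightarrow> 0"
proof -
  have YX: "(\<lambda>j. Y j - X j) \<longlonglongrightarrow> 0"
    using tendsto_diff[OF assms(1,2)] by simp
  have cYX: "(\<lambda>j. c j *\<^sub>R (Y j - X j)) \<longlonglongrightarrow> 0"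
    by (rule tendsto_0_le[OF YX, of _ C])
       (intro always_eventually allI, metis c mult.commute mult_right_mono norm_ge_zero norm_scaleR)
  have GYX: "(\<lambda>j. G j + c j *\<^sub>R (Y j - X j)) \<longlonglongrightarrow> H"
    using tendsto_add[OF assms(3) cYX] by simp
  have "(\<lambda>j. column t (G' j + penalty_grad q l0 J (Y j))) \<longlonglongrightarrow> 0" for t
  proof (cases "t \<in> J")
    case True
    have "column t (penalty_grad q l0 J (Y j))
        = (l0 / l j t) *\<^sub>R ((l j t * norm (column t (Y j)) powr (q - 2)) *\<^sub>R column t (Y j))" for j
      using l(3)[OF True, of j] True by (simp add: column_penalty_grad)
    then have "column t (penalty_grad q l0 J (Y j))
        = - ((l0 / l j t) *\<^sub>R column t (G j + c j *\<^sub>R (Y j - X j)))" for j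
      by (simp only: stat[OF True] scaleR_minus_right)
    then have eq: "column t (G' j + penalty_grad q l0 J (Y j))
        = column t (G' j) - (l0 / l j t) *\<^sub>R column t (G j + c j *\<^sub>R (Y j - X j))" for j
      by (simp only: column_simps(1)[of t "G' j"] diff_conv_add_uminus)
    have "(\<lambda>j. l0 / l j t) \<longlonglongrightarrow> l0 / l0"
      using l(1)[OF True] l(2) by (intro tendsto_intros) auto
    then have "(\<lambda>j. column t (G' j) - (l0 / l j t) *\<^sub>R column t (G j + c j *\<^sub>R (Y j - X j)))
        \<longlonglongrightarrow> column t H - (l0 / l0) *\<^sub>R column t H"
      by (intro tendsto_diff tendsto_scaleR bounded_linear.tendsto[OF bounded_linear_column] assms(4) GYX)
    then show ?thesis
      unfolding eq using l(2) by simp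
  next
    case False
    then show ?thesis
      using G' by (simp add: column_simps column_penalty_grad col_space_def)
  qed
  then have "(\<lambda>j. column t (G' j + penalty_grad q l0 J (Y j)) $ i) \<longlonglongrightarrow> 0 $ i" for t i
    by (rule tendsto_vec_nth)
  then show ?thesis
    by (intro vec_tendstoI) (simp add: column_def)
qed

lemma GDERIV_objective:
  fixes F :: "real ^ 'n ^ 'm \<Rightarrow> real" and A :: "real ^ 'd ^ 'm" and B :: "real ^ 'd ^ 'n"
  assumes "F differentiable (at (A ** transpose B))" and "q \<noteq> 0" "p \<noteq> 0"
    and "\<And>t. t \<in> J \<Longrightarrow> column t A \<noteq> 0" "\<And>t. t \<in> J \<Longrightarrow> column t B \<noteq> 0"
  shows "GDERIV (objective F q p J l) (A, B) :>
    (grad F (A ** transpose B) ** B + penalty_grad q l J A,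
     transpose (grad F (A ** transpose B)) ** A + penalty_grad p l J B)"
proof -
  let ?H = "grad F (A ** transpose B)"
  let ?f = "\<lambda>q A. l / q * (\<Sum>t\<in>J. norm (column t A) powr q)"
  have A: "((\<lambda>Z. ?f q (fst Z)) has_derivative (\<lambda>h. inner (fst h) (penalty_grad q l J A))) (at (A, B))"
    by (rule has_derivative_compose[OF has_derivative_fst[OF has_derivative_ident]])
       (use GDERIV_penalty[OF assms(2,4)] in \<open>simp only: gderiv_def fst_conv\<close>)
  have B: "((\<lambda>Z. ?f p (snd Z)) has_derivative (\<lambda>h. inner (snd h) (penalty_grad p l J B))) (at (A, B))"
    by (rule has_derivative_compose[OF has_derivative_snd[OF has_derivative_ident]])
       (use GDERIV_penalty[OF assms(3,5)] in \<open>simp only: gderiv_def snd_conv\<close>)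
  from has_derivative_add[OF has_derivative_add[OF
        GDERIV_mult_transpose[OF assms(1), unfolded gderiv_def] A] B]
  show ?thesis
    by (simp add: gderiv_def objective_def case_prod_unfold inner_prod_def inner_add_right algebra_simps)
qed

lemma matrix_mult_in_col_space:
  assumes "B \<in> col_space J"
  shows "(H :: real ^ 'n ^ 'm) ** B \<in> col_space J"
  using assms by (auto simp: col_space_def column_def matrix_matrix_mult_def vec_eq_iff)

text \<open>Positive exponents keep the penalties continuous at vanishing columns, where
  differentiability may fail. Hence objective values converge along every convergent sequence, even
  if columns vanish in the limit.\<close>

lemma continuous_on_objective:
  fixes F :: "real ^ 'n ^ 'm \<Rightarrow> real"
  assumes "continuous_on UNIV F" "q > 0" "p > 0"
  shows "continuous_on UNIV (objective F q p J l)"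
proof -
  have F: "continuous_on UNIV (\<lambda>Z. F (fst Z ** transpose (snd Z)))"
    by (rule continuous_on_compose2[OF assms(1)])
      (auto intro!: bounded_bilinear.continuous_on[OF bounded_bilinear_mult_transpose]
        continuous_intros)
  have "objective F q p J l = (\<lambda>Z. F (fst Z ** transpose (snd Z))
     + l / q * (\<Sum>t\<in>J. norm (column t (fst Z)) powr q)
     + l / p * (\<Sum>t\<in>J. norm (column t (snd Z)) powr p))"
    by (auto simp: objective_def)
  then show ?thesis
    using assms(2,3)
    by (auto intro!: F continuous_intros continuous_on_powr'
        bounded_linear.continuous_on[OF bounded_linear_column])
qed

section \<open>Convergence\<close>

text \<open>\<open>K\<close> is an iteration from which the set of columns is constant.
  \<open>beta_small\<close> is the squared form of the extrapolation bound; it starts strictly after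
  \<open>K\<close> so that index \<open>k - 1\<close> also belongs to the constant phase.\<close>

locale inexact_palm_convergence = inexact_palm +
  fixes K :: nat and l L :: real
  assumes q: "0 < q" "q \<le> 2" and p: "0 < p" "p \<le> 2"
    and J_const: "\<And>k. K \<le> k \<Longrightarrow> J k = J K"
    and F_diff: "\<And>X. F differentiable (at X)"
    and grad_F_cont: "continuous_on UNIV (grad F)"
    and F_bdd: "bdd_below (range F)"
    and lip1: "\<And>k. K \<le> k \<Longrightarrow>
      (L1 k / 2)-lipschitz_on (col_space (J K)) (grad (\<lambda>A. F (A ** transpose (V k))))"
    and lip2: "\<And>k. K \<le> k \<Longrightarrow>
      (L2 k / 2)-lipschitz_on (col_space (J K)) (grad (\<lambda>B. F (U (Suc k) ** transpose B)))"
    and l_pos: "0 < l"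
    and L_bounds: "\<And>k. K \<le> k \<Longrightarrow> l \<le> L1 k \<and> L1 k \<le> L \<and> l \<le> L2 k \<and> L2 k \<le> L"
    and beta_small: "\<And>k. K < k \<Longrightarrow> L1 k * (beta k)\<^sup>2 \<le> L1 (k - 1) / 36"
      "\<And>k. K < k \<Longrightarrow> L2 k * (beta k)\<^sup>2 \<le> L2 (k - 1) / 36"
begin

section \<open>Iterates after the last rank adjustment\<close>

lemma U_Suc: "K \<le> k \<Longrightarrow> U (Suc k) = U' k"
  and V_Suc: "K \<le> k \<Longrightarrow> V (Suc k) = V' k"
  using adjust_const[of k] J_const[of k] J_const[of "Suc k"] by simp_all

lemma U_col_space: "K \<le> k \<Longrightarrow> U k \<in> col_space (J K)"
  and V_col_space: "K \<le> k \<Longrightarrow> V k \<in> col_space (J K)"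
  unfolding J_const[of k, symmetric]
  \<comment> \<open>At index 0 all columns are active by \<open>J_init\<close>, so membership is
    trivial; later iterates are outputs of \<open>keep_columns\<close>.\<close>
  by (cases k; simp add: U_adjust V_adjust keep_columns_in_col_space; simp add: J_init col_space_def)+

text \<open>A column that survives \<open>J_step\<close> is nonzero in both factors, and
  \<open>K < k\<close> ensures that iterate \<open>k\<close> is the output of a step in which every
  column of \<open>J K\<close> survived.\<close>

lemma column_nonzero:
  assumes "K < k" "t \<in> J K"
  shows "column t (U k) \<noteq> 0" "column t (V k) \<noteq> 0"
proof -
  obtain j where j: "k = Suc j" "K \<le> j"
    using assms(1) by (metis Suc_le_eq less_iff_Suc_add less_Suc_eq_le)
  have "t \<in> J (Suc j)"
    using J_const[of "Suc j"] j assms(2) by simp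
  then show "column t (U k) \<noteq> 0" "column t (V k) \<noteq> 0"
    using U_Suc[OF j(2)] V_Suc[OF j(2)] by (auto simp: J_step j(1))
qed

definition X :: "nat \<Rightarrow> real ^ 'c ^ 'b" where
  "X k = U k + beta k *\<^sub>R (U k - U (k - 1))"

definition Y :: "nat \<Rightarrow> real ^ 'c ^ 'a" where
  "Y k = V k + beta k *\<^sub>R (V k - V (k - 1))"

text \<open>Strictness in \<open>K < k\<close> puts the iterate \<open>k - 1\<close> into
  \<open>col_space (J K)\<close> as well, so \<open>keep_columns\<close> acts as the
  identity.\<close>

lemma extrapolate_U: "K < k \<Longrightarrow> extrapolate (J k) (beta k) U k = X k"
  and extrapolate_V: "K < k \<Longrightarrow> extrapolate (J k) (beta k) V k = Y k"
  using U_col_space[of k] U_col_space[of "k - 1"] V_col_space[of k] V_col_space[of "k - 1"]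
  by (simp_all add: extrapolate_def X_def Y_def J_const[of k] keep_columns_col_space
      subspace_add subspace_scale subspace_diff col_space_subspace)

lemmas GDERIV_blocks = GDERIV_partial[OF GDERIV_mult_transpose[OF F_diff], simplified]

lemma grad_U: "grad (\<lambda>A. F (A ** transpose B)) A = grad F (A ** transpose B) ** B"
  by (rule grad_eqI[OF GDERIV_blocks(1)])

lemma grad_V: "grad (\<lambda>B. F (A ** transpose B)) B = transpose (grad F (A ** transpose B)) ** A"
  by (rule grad_eqI[OF GDERIV_blocks(2)])

lemma GDERIV_grad_U: "GDERIV (\<lambda>A. F (A ** transpose B)) A :> grad (\<lambda>A. F (A ** transpose B)) A"
  unfolding grad_U by (rule GDERIV_blocks(1))

lemma GDERIV_grad_V: "GDERIV (\<lambda>B. F (A ** transpose B)) B :> grad (\<lambda>B. F (A ** transpose B)) B"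
  unfolding grad_V by (rule GDERIV_blocks(2))

section \<open>Prox steps and descent of the perturbed objective\<close>

lemma U_prox:
  assumes "K < k" "t \<in> J K"
  shows "column t (U (Suc k)) \<in> prox (\<lambda>u. lam1 k t / (q * L1 k) * norm u powr q)
    (column t (X k - (1 / L1 k) *\<^sub>R grad (\<lambda>A. F (A ** transpose (V k))) (X k)))"
  using U_step[of t k] assms J_const[of k] by (simp add: extrapolate_U[OF assms(1), symmetric] U_Suc)

lemma V_prox:
  assumes "K < k" "t \<in> J K"
  shows "column t (V (Suc k)) \<in> prox (\<lambda>v. lam2 k t / (p * L2 k) * norm v powr p)
    (column t (Y k - (1 / L2 k) *\<^sub>R grad (\<lambda>B. F (U (Suc k) ** transpose B)) (Y k)))"
  using V_step[of t k] assms J_const[of k] by (simp add: extrapolate_V[OF assms(1), symmetric] V_Suc U_Suc)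

text \<open>The index \<open>j\<close> selects the perturbed parameters and \<open>k\<close> the
  iterate, so a change of either can be estimated separately.\<close>

definition Psi :: "nat \<Rightarrow> nat \<Rightarrow> real" where
  "Psi j k = perturbed_objective F q p (J K) (lam1 j) (lam2 j) (U k, V k)"

definition dist2 :: "nat \<Rightarrow> real" where
  "dist2 k = L1 k * (norm (U (Suc k) - U k))\<^sup>2 + L2 k * (norm (V (Suc k) - V k))\<^sup>2"

text \<open>Adding the descent of the two blocks cancels \<open>F\<close> at the mixed pair
  \<open>U (Suc k)\<close>, \<open>V k\<close>. The weights in \<open>dist2\<close> are those of the
  block estimates.\<close>

lemma Psi_descent:
  assumes "K < k"
  shows "Psi k (Suc k) + 1/8 * dist2 k \<le> Psi k k + 1/36 * dist2 (k - 1)"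
proof -
  have k: "K \<le> k" "K \<le> k - 1" "0 < k"
    using assms by auto
  have "F (U (Suc k) ** transpose (V k)) + (\<Sum>t\<in>J K. lam1 k t / q * norm (column t (U (Suc k))) powr q)
      + L1 k / 8 * (norm (U (Suc k) - U k))\<^sup>2
    \<le> F (U k ** transpose (V k)) + (\<Sum>t\<in>J K. lam1 k t / q * norm (column t (U k)) powr q)
      + L1 (k - 1) / 36 * (norm (U k - U (k - 1)))\<^sup>2"
    using assms k
    by (intro block_descent[OF GDERIV_grad_U lip1 U_col_space U_col_space U_col_space L_pos(1)
          X_def beta_small(1) U_prox]) auto
  moreover
  have "F (U (Suc k) ** transpose (V (Suc k)))
      + (\<Sum>t\<in>J K. lam2 k t / p * norm (column t (V (Suc k))) powr p)
      + L2 k / 8 * (norm (V (Suc k) - V k))\<^sup>2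
    \<le> F (U (Suc k) ** transpose (V k)) + (\<Sum>t\<in>J K. lam2 k t / p * norm (column t (V k)) powr p)
      + L2 (k - 1) / 36 * (norm (V k - V (k - 1)))\<^sup>2"
    using assms k
    by (intro block_descent[OF GDERIV_grad_V lip2 V_col_space V_col_space V_col_space L_pos(2)
          Y_def beta_small(2) V_prox]) auto
  ultimately show ?thesis
    using k(3) by (simp add: Psi_def dist2_def perturbed_objective_def algebra_simps)
qed

section \<open>Regularization parameters and their perturbations\<close>

lemma lam_ge: "lam_min \<le> lam k"
  using lam_init by (cases k) (auto simp: lam_step)

lemma lam_pos: "0 < lam k"
  using lam_ge[of k] lam_min_pos by linarith

lemma lam_antimono: "lam (Suc k) \<le> lam k"
  using lam_ge[of k] lam_pos[of k] rho by (simp add: lam_step)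

lemma lam_le: "lam k \<le> lam_min + rho ^ k * lam 0"
proof (induction k)
  case (Suc k)
  have "rho * lam k \<le> rho * lam_min + rho ^ Suc k * lam 0"
    using mult_left_mono[OF Suc.IH, of rho] rho by (simp add: algebra_simps)
  moreover have "rho * lam_min \<le> lam_min"
    using rho lam_min_pos by simp
  moreover have "0 \<le> rho ^ Suc k * lam 0"
    using rho lam_pos[of 0] by simp
  ultimately show ?case
    unfolding lam_step by (intro max.boundedI) linarith+
qed (use lam_min_pos in simp)

lemma lam_tendsto: "lam \<longlonglongrightarrow> lam_min"
proof (rule tendsto_sandwich[OF _ _ tendsto_const])
  have "(\<lambda>k. lam_min + rho ^ k * lam 0) \<longlonglongrightarrow> lam_min + 0 * lam 0"
    using rho by (intro tendsto_intros LIMSEQ_realpow_zero) auto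
  then show "(\<lambda>k. lam_min + rho ^ k * lam 0) \<longlonglongrightarrow> lam_min"
    by simp
qed (use lam_ge lam_le in \<open>auto intro!: always_eventually\<close>)

lemma lam12_ge:
  assumes "K \<le> k" "t \<in> J K"
  shows "lam_min / exp 1 \<le> lam1 k t" "lam_min / exp 1 \<le> lam2 k t"
proof -
  have t: "t \<in> J k"
    using J_const[OF assms(1)] assms(2) by simp
  \<comment> \<open>Both parameter pairs of \<open>powr_ratio_step\<close> are taken at iteration
    \<open>k\<close>; only its first conclusion matters here.\<close>
  have "lam k \<le> exp 1 * lam1 k t"
    by (rule powr_ratio_step(1)[OF lam_pos[of k] order_refl _ _ _ _ lam1_inexact[OF t] _ _ lam1_inexact[OF t]])
       (use q delta_range lam12_pos[OF t] in auto)
  moreover have "lam k \<le> exp 1 * lam2 k t"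
    by (rule powr_ratio_step(1)[OF lam_pos[of k] order_refl _ _ _ _ lam2_inexact[OF t] _ _ lam2_inexact[OF t]])
       (use p delta_range lam12_pos[OF t] in auto)
  ultimately show "lam_min / exp 1 \<le> lam1 k t" "lam_min / exp 1 \<le> lam2 k t"
    using lam_ge[of k] by (simp_all add: field_simps)
qed

definition err :: "nat \<Rightarrow> real" where
  "err k = 3 * (delta k + 2 * delta (Suc k))"

lemma err_nonneg: "0 \<le> err k"
  using delta_range by (simp add: err_def)

lemma summable_err: "summable err"
  unfolding err_def
  by (intro summable_mult summable_add delta_summable) (simp add: summable_Suc_iff delta_summable)

lemma lam12_step:
  assumes "K \<le> k" "t \<in> J K"
  shows "lam1 (Suc k) t \<le> exp (err k) * lam1 k t" "lam2 (Suc k) t \<le> exp (err k) * lam2 k t"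
proof -
  have t: "t \<in> J k" "t \<in> J (Suc k)"
    using J_const[of k] J_const[of "Suc k"] assms by simp_all
  show "lam1 (Suc k) t \<le> exp (err k) * lam1 k t"
    unfolding err_def
    by (rule powr_ratio_step(2)[OF lam_pos lam_antimono[of k] _ _ _ _ lam1_inexact[OF t(1)] _ _ lam1_inexact[OF t(2)]])
       (use q delta_range lam12_pos[OF t(1)] lam12_pos[OF t(2)] in auto)
  show "lam2 (Suc k) t \<le> exp (err k) * lam2 k t"
    unfolding err_def
    by (rule powr_ratio_step(2)[OF lam_pos lam_antimono[of k] _ _ _ _ lam2_inexact[OF t(1)] _ _ lam2_inexact[OF t(2)]])
       (use p delta_range lam12_pos[OF t(1)] lam12_pos[OF t(2)] in auto)
qed

lemma lam12_tendsto:
  assumes "t \<in> J K"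
  shows "(\<lambda>k. lam1 k t) \<longlonglongrightarrow> lam_min" "(\<lambda>k. lam2 k t) \<longlonglongrightarrow> lam_min"
proof -
  have t: "t \<in> J (k + K)" for k
    using J_const[of "k + K"] assms by simp
  note lims = LIMSEQ_ignore_initial_segment[OF lam_tendsto, of K]
    LIMSEQ_ignore_initial_segment[OF delta_tendsto, of K]
  have "(\<lambda>k. lam1 (k + K) t) \<longlonglongrightarrow> lam_min"
    by (rule powr_ratio_tendsto_1[OF lims(1) lam_min_pos lam_pos lam12_pos(1)[OF t] _ lam1_inexact[OF t] lims(2)])
       (use q in simp)
  then show "(\<lambda>k. lam1 k t) \<longlonglongrightarrow> lam_min"
    by (rule LIMSEQ_offset)
  have "(\<lambda>k. lam2 (k + K) t) \<longlonglongrightarrow> lam_min"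
    by (rule powr_ratio_tendsto_1[OF lims(1) lam_min_pos lam_pos lam12_pos(2)[OF t] _ lam2_inexact[OF t] lims(2)])
       (use p in simp)
  then show "(\<lambda>k. lam2 k t) \<longlonglongrightarrow> lam_min"
    by (rule LIMSEQ_offset)
qed

section \<open>Energy estimate\<close>

definition F_inf :: real where "F_inf = Inf (range F)"

lemma F_inf_le: "F_inf \<le> F Z"
  unfolding F_inf_def by (rule cInf_lower[OF _ F_bdd]) simp

lemma penalty_nonneg:
  assumes "K \<le> j"
  shows "0 \<le> (\<Sum>t\<in>J K. lam1 j t / q * norm (column t A) powr q)"
    "0 \<le> (\<Sum>t\<in>J K. lam2 j t / p * norm (column t B) powr p)"
  using lam12_pos[of _ j] J_const[OF assms] q(1) p(1) by (auto intro!: sum_nonneg simp: less_imp_le)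

text \<open>Each penalty grows by at most the factor \<open>exp (err k)\<close>. The loss does not
  change, but after subtracting \<open>F_inf\<close> it is nonnegative and may be multiplied by a
  factor at least 1.\<close>

lemma Psi_step:
  assumes "K \<le> k"
  shows "Psi (Suc k) n - F_inf \<le> exp (err k) * (Psi k n - F_inf)"
proof -
  have "(\<Sum>t\<in>J K. lam1 (Suc k) t / q * norm (column t (U n)) powr q)
      \<le> (\<Sum>t\<in>J K. exp (err k) * (lam1 k t / q * norm (column t (U n)) powr q))"
  proof (rule sum_mono)
    fix t assume "t \<in> J K"
    from lam12_step(1)[OF assms this] q(1)
    have "lam1 (Suc k) t / q * norm (column t (U n)) powr q
        \<le> exp (err k) * lam1 k t / q * norm (column t (U n)) powr q"
      by (intro mult_right_mono divide_right_mono) auto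
    then show "lam1 (Suc k) t / q * norm (column t (U n)) powr q
        \<le> exp (err k) * (lam1 k t / q * norm (column t (U n)) powr q)"
      by (simp add: mult.assoc)
  qed
  moreover have "(\<Sum>t\<in>J K. lam2 (Suc k) t / p * norm (column t (V n)) powr p)
      \<le> (\<Sum>t\<in>J K. exp (err k) * (lam2 k t / p * norm (column t (V n)) powr p))"
  proof (rule sum_mono)
    fix t assume "t \<in> J K"
    from lam12_step(2)[OF assms this] p(1)
    have "lam2 (Suc k) t / p * norm (column t (V n)) powr p
        \<le> exp (err k) * lam2 k t / p * norm (column t (V n)) powr p"
      by (intro mult_right_mono divide_right_mono) auto
    then show "lam2 (Suc k) t / p * norm (column t (V n)) powr p
        \<le> exp (err k) * (lam2 k t / p * norm (column t (V n)) powr p)"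
      by (simp add: mult.assoc)
  qed
  moreover have "F (U n ** transpose (V n)) - F_inf \<le> exp (err k) * (F (U n ** transpose (V n)) - F_inf)"
    using F_inf_le[of "U n ** transpose (V n)"] err_nonneg[of k]
      mult_right_mono[of 1 "exp (err k)" "F (U n ** transpose (V n)) - F_inf"] by simp
  ultimately show ?thesis
    by (simp add: Psi_def perturbed_objective_def right_diff_distrib distrib_left sum_distrib_left)
qed

lemma Psi_ge: "K \<le> j \<Longrightarrow> F_inf \<le> Psi j k"
  using penalty_nonneg(1)[of j "U k"] penalty_nonneg(2)[of j "V k"] F_inf_le[of "U k ** transpose (V k)"]
  by (simp add: Psi_def perturbed_objective_def)

lemma dist2_nonneg: "0 \<le> dist2 k"
  using L_pos[of k] by (simp add: dist2_def)

text \<open>A Lyapunov function: the term \<open>1/36 * dist2 k\<close> stores the extrapolation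
  error that the next descent step will charge.\<close>

definition energy :: "nat \<Rightarrow> real" where
  "energy k = Psi k (Suc k) - F_inf + 1/36 * dist2 k"

text \<open>Of the guaranteed decrease 1/8, the part 1/36 goes into the new energy, and 7/72 is left
  over to make the squared steps summable.\<close>

lemma energy_step:
  assumes "K \<le> k"
  shows "energy (Suc k) + 7/72 * dist2 (Suc k) \<le> exp (err k) * energy k"
proof -
  have "energy (Suc k) + 7/72 * dist2 (Suc k) \<le> Psi (Suc k) (Suc k) - F_inf + 1/36 * dist2 k"
    using Psi_descent[of "Suc k"] assms by (simp add: energy_def)
  also have "\<dots> \<le> exp (err k) * (Psi k (Suc k) - F_inf) + exp (err k) * (1/36 * dist2 k)"
    using Psi_step[OF assms, of "Suc k"] err_nonneg[of k] dist2_nonneg[of k]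
      mult_right_mono[of 1 "exp (err k)" "1/36 * dist2 k"] by (intro add_mono) auto
  finally show ?thesis
    by (simp add: energy_def algebra_simps)
qed

lemma energy_nonneg: "K \<le> k \<Longrightarrow> 0 \<le> energy k"
  using Psi_ge[of k "Suc k"] dist2_nonneg[of k] by (simp add: energy_def)

lemma energy_bounded: "K \<le> k \<Longrightarrow> energy k \<le> exp (\<Sum>i. err (i + K)) * energy K"
  and summable_dist2: "summable dist2"
proof -
  have step: "energy (Suc k + K) + 7/72 * dist2 (Suc k + K) \<le> exp (err (k + K)) * energy (k + K)" for k
    using energy_step[of "k + K"] by simp
  have err: "summable (\<lambda>i. err (i + K))"
    by (simp add: summable_iff_shift summable_err)
  note * = quasi_descent_summable[of "\<lambda>k. energy (k + K)" "\<lambda>k. 7/72 * dist2 (Suc k + K)",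
      OF energy_nonneg[OF le_add2] mult_nonneg_nonneg[OF _ dist2_nonneg] err_nonneg err step]
  show "energy k \<le> exp (\<Sum>i. err (i + K)) * energy K" if "K \<le> k"
    using *(1)[of "k - K"] that by simp
  from *(2) have "summable (\<lambda>k. dist2 (k + Suc K))"
    by simp
  then show "summable dist2"
    by (subst (asm) summable_iff_shift)
qed

section \<open>Vanishing steps and bounded iterates\<close>

lemma summable_steps:
  "summable (\<lambda>k. (norm (U (Suc k) - U k))\<^sup>2)" "summable (\<lambda>k. (norm (V (Suc k) - V k))\<^sup>2)"
proof -
  have le: "(norm (U (Suc k) - U k))\<^sup>2 \<le> dist2 k / l" "(norm (V (Suc k) - V k))\<^sup>2 \<le> dist2 k / l"
    if "K \<le> k" for k
  proof -
    have "l * (norm (U (Suc k) - U k))\<^sup>2 \<le> L1 k * (norm (U (Suc k) - U k))\<^sup>2"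
         "l * (norm (V (Suc k) - V k))\<^sup>2 \<le> L2 k * (norm (V (Suc k) - V k))\<^sup>2"
      using L_bounds[OF that] by (auto intro: mult_right_mono)
    moreover have "0 \<le> L1 k * (norm (U (Suc k) - U k))\<^sup>2" "0 \<le> L2 k * (norm (V (Suc k) - V k))\<^sup>2"
      using L_pos[of k] by simp_all
    ultimately have "l * (norm (U (Suc k) - U k))\<^sup>2 \<le> dist2 k" "l * (norm (V (Suc k) - V k))\<^sup>2 \<le> dist2 k"
      unfolding dist2_def by linarith+
    then show "(norm (U (Suc k) - U k))\<^sup>2 \<le> dist2 k / l" "(norm (V (Suc k) - V k))\<^sup>2 \<le> dist2 k / l"
      using l_pos by (simp_all add: field_simps)
  qed
  have "summable (\<lambda>k. dist2 k / l)"
    by (rule summable_divide[OF summable_dist2])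
  then show "summable (\<lambda>k. (norm (U (Suc k) - U k))\<^sup>2)" "summable (\<lambda>k. (norm (V (Suc k) - V k))\<^sup>2)"
    by (rule summable_comparison_test'[of _ K], use le in simp)+
qed

lemma steps_tendsto_0:
  "(\<lambda>k. U (Suc k) - U k) \<longlonglongrightarrow> 0" "(\<lambda>k. V (Suc k) - V k) \<longlonglongrightarrow> 0"
proof -
  have "(\<lambda>k. sqrt ((norm (U (Suc k) - U k))\<^sup>2)) \<longlonglongrightarrow> sqrt 0"
       "(\<lambda>k. sqrt ((norm (V (Suc k) - V k))\<^sup>2)) \<longlonglongrightarrow> sqrt 0"
    by (intro tendsto_real_sqrt summable_LIMSEQ_zero summable_steps)+
  then show "(\<lambda>k. U (Suc k) - U k) \<longlonglongrightarrow> 0" "(\<lambda>k. V (Suc k) - V k) \<longlonglongrightarrow> 0"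
    by (simp_all add: tendsto_norm_zero_iff)
qed

lemma bounded_iterates: "bounded (range U)" "bounded (range V)"
proof -
  define M where "M = exp (\<Sum>i. err (i + K)) * energy K"
  define c where "c = lam_min / exp 1"
  define RU where "RU = real (card (J K)) * ((q * M / c) powr (1 / q))\<^sup>2"
  define RV where "RV = real (card (J K)) * ((p * M / c) powr (1 / p))\<^sup>2"
  have c: "0 < c"
    using lam_min_pos by (simp add: c_def)
  have "(norm (U (k + Suc K)))\<^sup>2 \<le> RU \<and> (norm (V (k + Suc K)))\<^sup>2 \<le> RV" for k
  proof
    let ?k = "k + K"
    have "Psi ?k (Suc ?k) - F_inf \<le> M"
      using energy_bounded[of ?k] dist2_nonneg[of ?k] by (simp add: energy_def M_def)
    \<comment> \<open>The loss above \<open>F_inf\<close> and both penalties are nonnegative, so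
      each penalty alone is at most \<open>M\<close>.\<close>
    then have bound: "(\<Sum>t\<in>J K. lam1 ?k t / q * norm (column t (U (Suc ?k))) powr q) \<le> M"
      "(\<Sum>t\<in>J K. lam2 ?k t / p * norm (column t (V (Suc ?k))) powr p) \<le> M"
      using penalty_nonneg(1)[of ?k "U (Suc ?k)"] penalty_nonneg(2)[of ?k "V (Suc ?k)"]
        F_inf_le[of "U (Suc ?k) ** transpose (V (Suc ?k))"]
      by (simp_all add: Psi_def perturbed_objective_def)
    show "(norm (U (k + Suc K)))\<^sup>2 \<le> RU"
      unfolding RU_def
      using penalty_bound[OF U_col_space c q(1) _ bound(1)] lam12_ge(1)[of ?k] by (simp add: c_def)
    show "(norm (V (k + Suc K)))\<^sup>2 \<le> RV"
      unfolding RV_def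
      using penalty_bound[OF V_col_space c p(1) _ bound(2)] lam12_ge(2)[of ?k] by (simp add: c_def)
  qed
  then have "norm (U (k + Suc K)) \<le> sqrt RU" "norm (V (k + Suc K)) \<le> sqrt RV" for k
    by (simp_all add: real_le_rsqrt)
  then have "Bseq (\<lambda>k. U (k + Suc K))" "Bseq (\<lambda>k. V (k + Suc K))"
    by (auto intro!: BseqI')
  then show "bounded (range U)" "bounded (range V)"
    unfolding Bseq_eq_bounded[symmetric] by (blast dest: Bseq_offset)+
qed

lemma continuous_objective: "continuous_on UNIV (objective F q p I c)"
  by (intro continuous_on_objective q p)
     (simp add: continuous_on_eq_continuous_at differentiable_imp_continuous_within F_diff)

text \<open>The iterates have no vanishing active columns, so the objective is differentiable there and
  the limiting subgradients can be taken to be gradients.\<close>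

lemma limit_critical:
  assumes s: "filterlim s at_top sequentially" and K: "\<And>j. K < s j"
    and lim: "(\<lambda>j. U (Suc (s j))) \<longlonglongrightarrow> A" "(\<lambda>j. V (Suc (s j))) \<longlonglongrightarrow> B"
  shows "critical_point (col_space (J K) \<times> col_space (J K)) (objective F q p (J K) lam_min) (A, B)"
proof -
  let ?U = "\<lambda>j. U (Suc (s j))" and ?V = "\<lambda>j. V (Suc (s j))"
  let ?H = "\<lambda>A B. grad F (A ** transpose B)"
  let ?obj = "objective F q p (J K) lam_min"
  define gU where "gU j = ?H (?U j) (?V j) ** ?V j + penalty_grad q lam_min (J K) (?U j)" for j
  define gV where "gV j = transpose (?H (?U j) (?V j)) ** ?U j + penalty_grad p lam_min (J K) (?V j)" for j
  have K': "K \<le> s j" "K \<le> Suc (s j)" "K < Suc (s j)" for j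
    using K[of j] by simp_all
  have s': "filterlim (\<lambda>j. s j - 1) at_top sequentially"
    using filterlim_compose[OF filterlim_minus_const_nat_at_top s] by simp
  \<comment> \<open>Consecutive iterates have the same limit because the steps vanish; with
    \<open>beta\<close> bounded, the extrapolated points inherit it too.\<close>
  have U0: "(\<lambda>j. U (s j)) \<longlonglongrightarrow> A"
    using tendsto_diff[OF lim(1) filterlim_compose[OF steps_tendsto_0(1) s]] by simp
  have V0: "(\<lambda>j. V (s j)) \<longlonglongrightarrow> B"
    using tendsto_diff[OF lim(2) filterlim_compose[OF steps_tendsto_0(2) s]] by simp
  \<comment> \<open>\<open>K < s j\<close> makes \<open>s j\<close> positive, so the truncated
    subtraction is harmless.\<close>
  have Suc_s: "Suc (s j - 1) = s j" for j
    using K[of j] by simp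
  have X0: "(\<lambda>j. X (s j)) \<longlonglongrightarrow> A"
  proof -
    have "(\<lambda>j. U (s j) - U (s j - 1)) \<longlonglongrightarrow> 0"
      using filterlim_compose[OF steps_tendsto_0(1) s'] by (simp only: Suc_s)
    then have "(\<lambda>j. beta (s j) *\<^sub>R (U (s j) - U (s j - 1))) \<longlonglongrightarrow> 0"
      by (rule tendsto_0_le[where K = beta_max])
         (use beta_range in \<open>auto intro!: always_eventually simp: mult.commute intro: mult_right_mono\<close>)
    from tendsto_add[OF U0 this] show ?thesis
      by (simp add: X_def)
  qed
  have Y0: "(\<lambda>j. Y (s j)) \<longlonglongrightarrow> B"
  proof -
    have "(\<lambda>j. V (s j) - V (s j - 1)) \<longlonglongrightarrow> 0"
      using filterlim_compose[OF steps_tendsto_0(2) s'] by (simp only: Suc_s)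
    then have "(\<lambda>j. beta (s j) *\<^sub>R (V (s j) - V (s j - 1))) \<longlonglongrightarrow> 0"
      by (rule tendsto_0_le[where K = beta_max])
         (use beta_range in \<open>auto intro!: always_eventually simp: mult.commute intro: mult_right_mono\<close>)
    from tendsto_add[OF V0 this] show ?thesis
      by (simp add: Y_def)
  qed
  have grad_tendsto: "(\<lambda>j. ?H (P j) (Q j)) \<longlonglongrightarrow> ?H A B" if "P \<longlonglongrightarrow> A" "Q \<longlonglongrightarrow> B" for P Q
    by (rule continuous_on_tendsto_compose[OF grad_F_cont])
       (auto intro!: tendsto_matrix_mult tendsto_transpose that)
  have L: "\<bar>L1 (s j)\<bar> \<le> L" "\<bar>L2 (s j)\<bar> \<le> L" for j
    using L_bounds[OF K'(1)[of j]] L_pos[of "s j"] by auto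
  \<comment> \<open>Stationarity of the \<open>U\<close> block holds with the gradient at
    \<open>X (s j)\<close> and the old \<open>V (s j)\<close>, whereas \<open>gU\<close> uses the
    new pair; continuity of \<open>grad F\<close> gives both gradients the same limit.\<close>
  have gU: "gU \<longlonglongrightarrow> 0"
    unfolding gU_def
  proof (rule block_gradient_tendsto_0[where X = "\<lambda>j. X (s j)" and c = "\<lambda>j. L1 (s j)"
        and l = "\<lambda>j. lam1 (s j)" and G = "\<lambda>j. ?H (X (s j)) (V (s j)) ** V (s j)" and C = L])
    show "(\<lambda>j. ?H (X (s j)) (V (s j)) ** V (s j)) \<longlonglongrightarrow> ?H A B ** B"
      "(\<lambda>j. ?H (?U j) (?V j) ** ?V j) \<longlonglongrightarrow> ?H A B ** B"
      by (intro tendsto_matrix_mult grad_tendsto lim X0 V0)+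
    show "(lam1 (s j) t * norm (column t (?U j)) powr (q - 2)) *\<^sub>R column t (?U j)
        = - column t (?H (X (s j)) (V (s j)) ** V (s j) + L1 (s j) *\<^sub>R (?U j - X (s j)))"
      if "t \<in> J K" for j t
      using block_stationary[OF L_pos(1) q(1) column_nonzero(1)[OF K'(3) that] U_prox[OF K that]]
      by (simp add: grad_U)
  qed (use lim X0 L lam_min_pos lam12_pos(1)[of _ "s _"] J_const[OF K'(1)] V_col_space[OF K'(2)]
      filterlim_compose[OF lam12_tendsto(1) s] in \<open>auto intro: matrix_mult_in_col_space\<close>)
  \<comment> \<open>The \<open>V\<close> update already uses the new \<open>U\<close>, so only the
    \<open>V\<close> argument differs from the new pair.\<close>
  have gV: "gV \<longlonglongrightarrow> 0"
    unfolding gV_def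
  proof (rule block_gradient_tendsto_0[where X = "\<lambda>j. Y (s j)" and c = "\<lambda>j. L2 (s j)"
        and l = "\<lambda>j. lam2 (s j)" and G = "\<lambda>j. transpose (?H (?U j) (Y (s j))) ** ?U j" and C = L])
    show "(\<lambda>j. transpose (?H (?U j) (Y (s j))) ** ?U j) \<longlonglongrightarrow> transpose (?H A B) ** A"
      "(\<lambda>j. transpose (?H (?U j) (?V j)) ** ?U j) \<longlonglongrightarrow> transpose (?H A B) ** A"
      by (intro tendsto_matrix_mult tendsto_transpose grad_tendsto lim Y0)+
    show "(lam2 (s j) t * norm (column t (?V j)) powr (p - 2)) *\<^sub>R column t (?V j)
        = - column t (transpose (?H (?U j) (Y (s j))) ** ?U j + L2 (s j) *\<^sub>R (?V j - Y (s j)))"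
      if "t \<in> J K" for j t
      using block_stationary[OF L_pos(2) p(1) column_nonzero(2)[OF K'(3) that] V_prox[OF K that]]
      by (simp add: grad_V)
  qed (use lim Y0 L lam_min_pos lam12_pos(2)[of _ "s _"] J_const[OF K'(1)] U_col_space[OF K'(2)]
      filterlim_compose[OF lam12_tendsto(2) s] in \<open>auto intro: matrix_mult_in_col_space\<close>)
  let ?S = "col_space (J K) \<times> col_space (J K)"
  have iter: "(?U j, ?V j) \<in> ?S" for j
    using U_col_space[OF K'(2)] V_col_space[OF K'(2)] by simp
  have pen: "penalty_grad r c (J K) Z \<in> col_space (J K)" for r c and Z :: "real ^ 'c ^ 'z"
    by (simp add: col_space_def column_penalty_grad)
  have "(gU j, gV j) \<in> frechet_subdifferential ?S ?obj (?U j, ?V j)" for j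
    unfolding gU_def gV_def
    using q(1) p(1) column_nonzero[OF K'(3)] iter
    by (intro GDERIV_imp_frechet_subdifferential GDERIV_objective F_diff)
       (auto intro!: subspace_add[OF col_space_subspace] pen matrix_mult_in_col_space)
  moreover have lim': "(\<lambda>j. (?U j, ?V j)) \<longlonglongrightarrow> (A, B)"
    by (intro tendsto_Pair lim)
  moreover have "(\<lambda>j. ?obj (?U j, ?V j)) \<longlonglongrightarrow> ?obj (A, B)"
    using continuous_on_tendsto_compose[OF continuous_objective lim'] by simp
  moreover have "(\<lambda>j. (gU j, gV j)) \<longlonglongrightarrow> 0"
    using tendsto_Pair[OF gU gV] by (simp add: zero_prod_def)
  ultimately have "0 \<in> limiting_subdifferential ?S ?obj (A, B)"
    using iter unfolding limiting_subdifferential_def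
    by (intro CollectI exI[of _ "\<lambda>j. (?U j, ?V j)"] exI[of _ "\<lambda>j. (gU j, gV j)"]) blast
  moreover have "(A, B) \<in> ?S"
    using Lim_in_closed_set[OF _ always_eventually _ lim', of ?S] iter
    by (auto simp: closed_Times closed_subspace col_space_subspace)
  ultimately show ?thesis
    by (simp add: critical_point_def)
qed

end

theorem theorem5p2:
  fixes F :: "real ^ 'n ^ 'm \<Rightarrow> real"
    and q p lam_min rho beta_max l L delta_beta :: real
    and lam L1 L2 delta beta :: "nat \<Rightarrow> real"
    and lam1 lam2 :: "nat \<Rightarrow> 'd::finite \<Rightarrow> real"
    and J :: "nat \<Rightarrow> 'd set"
    and U U' :: "nat \<Rightarrow> real ^ 'd ^ 'm"
    and V V' :: "nat \<Rightarrow> real ^ 'd ^ 'n"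
    and K :: nat
    and W :: "nat \<Rightarrow> (real ^ 'd ^ 'm) \<times> (real ^ 'd ^ 'n)"
    and S :: "((real ^ 'd ^ 'm) \<times> (real ^ 'd ^ 'n)) set"
    and Phi :: "(real ^ 'd ^ 'm) \<times> (real ^ 'd ^ 'n) \<Rightarrow> real"
  assumes q: "0 < q" "q \<le> 2" and p: "0 < p" "p \<le> 2"
    and alg: "inexact_palm F q p lam_min rho beta_max lam L1 L2 delta beta lam1 lam2 J U U' V V'"
    \<comment> \<open>iterates are considered from iteration \<open>K\<close> on, when the number of columns has become constant\<close>
    and K: "\<forall>k\<ge>K. J k = J K"
    and W_def: "W = (\<lambda>k. (U (K + k), V (K + k)))"
    and S_def: "S = col_space (J K) \<times> col_space (J K)"
    and Phi_def: "Phi = objective F q p (J K) lam_min"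
    and A1: "\<forall>X. F differentiable (at X)" "continuous_on UNIV (grad F)" "bdd_below (range F)"
    and A2: "\<exists>Z. critical_point S Phi Z"
    and A3: "\<forall>k\<ge>K. (L1 k / 2)-lipschitz_on (col_space (J K)) (grad (\<lambda>A. F (A ** transpose (V k))))"
      "\<forall>k\<ge>K. (L2 k / 2)-lipschitz_on (col_space (J K)) (grad (\<lambda>B. F (U (Suc k) ** transpose B)))"
      "0 < l" "l < L" "\<forall>k\<ge>K. l \<le> L1 k \<and> L1 k \<le> L \<and> l \<le> L2 k \<and> L2 k \<le> L"
    and C: "\<forall>k\<ge>K. perturbed_objective F q p (J K) (lam1 k) (lam2 k) (U (Suc k), V (Suc k))
              \<le> perturbed_objective F q p (J K) (lam1 k) (lam2 k) (U k, V k)"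
      "delta_beta < 1"
      "\<forall>k\<ge>K. 1 \<le> k \<longrightarrow> 0 \<le> beta k \<and>
         beta k \<le> 1/6 * delta_beta * min (sqrt (L1 (k - 1) / L1 k)) (sqrt (L2 (k - 1) / L2 k))"
  shows "bounded (range W)
    \<and> summable (\<lambda>k. (norm (W (Suc k) - W k))\<^sup>2)
    \<and> (\<forall>Wbar. (\<exists>r. strict_mono r \<and> (W \<circ> r) \<longlonglongrightarrow> Wbar) \<longrightarrow> critical_point S Phi Wbar)
    \<and> (\<forall>r Wbar. strict_mono r \<and> (W \<circ> r) \<longlonglongrightarrow> Wbar \<longrightarrow> (\<lambda>k. Phi (W (r k))) \<longlonglongrightarrow> Phi Wbar)"
proof -
  interpret inexact_palm F q p lam_min rho beta_max lam L1 L2 delta beta lam1 lam2 J U U' V V'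
    by (rule alg)
  \<comment> \<open>Squaring the factor 1/6 of the extrapolation bound yields the 1/36;
    \<open>m\<close> stands for the minimum of the two roots, so the same estimate serves both
    blocks.\<close>
  have beta_sq: "c * b\<^sup>2 \<le> c' / 36"
    if "0 \<le> b" "b \<le> 1/6 * delta_beta * m" "0 \<le> m" "m \<le> sqrt (c' / c)" "0 < c" "0 < c'"
    for b m c c' :: real
  proof -
    have "delta_beta * m \<le> 1 * m"
      using C(2) that(3) by (intro mult_right_mono) auto
    then have "b \<le> 1/6 * sqrt (c' / c)"
      using that(2,4) by linarith
    then have "b\<^sup>2 \<le> (1/6 * sqrt (c' / c))\<^sup>2"
      using that(1) by (rule power_mono)
    then show ?thesis
      using that(5,6) by (simp add: power_mult_distrib field_simps)
  qed
  interpret inexact_palm_convergence F q p lam_min rho beta_max lam L1 L2 delta beta lam1 lam2 J U U' V V' K l L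
  proof
    fix k assume k: "K < k"
    then have b: "0 \<le> beta k" "beta k \<le> 1/6 * delta_beta * min (sqrt (L1 (k - 1) / L1 k)) (sqrt (L2 (k - 1) / L2 k))"
      using C(3) by auto
    have m: "0 \<le> min (sqrt (L1 (k - 1) / L1 k)) (sqrt (L2 (k - 1) / L2 k))"
      using L_pos by (simp add: less_imp_le)
    show "L1 k * (beta k)\<^sup>2 \<le> L1 (k - 1) / 36" "L2 k * (beta k)\<^sup>2 \<le> L2 (k - 1) / 36"
      by (rule beta_sq[OF b m]; simp add: L_pos)+
  qed (use q p K A1 A3 in blast)+
  have norm_step: "(norm (W (Suc k) - W k))\<^sup>2 =
      (norm (U (Suc (k + K)) - U (k + K)))\<^sup>2 + (norm (V (Suc (k + K)) - V (k + K)))\<^sup>2" for k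
    by (simp add: W_def norm_prod_def add.commute)
  have "range W \<subseteq> range U \<times> range V"
    by (auto simp: W_def)
  then have "bounded (range W)"
    using bounded_subset bounded_Times bounded_iterates by blast
  moreover have "summable (\<lambda>k. (norm (W (Suc k) - W k))\<^sup>2)"
    unfolding norm_step
    by (intro summable_add) (use summable_steps[THEN summable_ignore_initial_segment, of K] in simp_all)
  moreover have "critical_point S Phi Wbar" if r: "strict_mono r" "(W \<circ> r) \<longlonglongrightarrow> Wbar" for r Wbar
  proof -
    obtain A B where AB: "Wbar = (A, B)"
      by (cases Wbar)
    \<comment> \<open>\<open>s j\<close> is the step that outputs \<open>W (r (j + 2))\<close>. The
      shift by 2 forces \<open>r (j + 2)\<close> to be at least 2, whence
      \<open>K < s j\<close>.\<close>
    define s where "s j = K + r (j + 2) - 1" for j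
    have r_ge: "j + 2 \<le> r (j + 2)" for j
      by (rule strict_mono_imp_increasing[OF r(1)])
    have s: "Suc (s j) = K + r (j + 2)" "K < s j" "j \<le> s j" for j
      using r_ge[of j] by (auto simp: s_def)
    have "(\<lambda>j. (W \<circ> r) (j + 2)) \<longlonglongrightarrow> (A, B)"
      using r(2) unfolding AB by (rule LIMSEQ_ignore_initial_segment)
    then have lim: "(\<lambda>j. (U (Suc (s j)), V (Suc (s j)))) \<longlonglongrightarrow> (A, B)"
      by (simp add: W_def s(1))
    have "filterlim s at_top sequentially"
      by (rule filterlim_at_top_mono[OF filterlim_ident]) (simp add: s(3))
    then show ?thesis
      unfolding AB S_def Phi_def
      using limit_critical[OF _ s(2)] tendsto_fst[OF lim] tendsto_snd[OF lim] by simp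
  qed
  moreover have "(\<lambda>k. Phi (W (r k))) \<longlonglongrightarrow> Phi Wbar" if "(W \<circ> r) \<longlonglongrightarrow> Wbar" for r Wbar
    using continuous_on_tendsto_compose[OF continuous_objective that] by (simp add: Phi_def)
  ultimately show ?thesis
    by blast
qed

end
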